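(* Let $p\ge 3$ be a prime and let $k$ be a field of characteristic $p$. Let $\lambda=(\lambda_1,\dots,\lambda_r)\vdash n$ be a partition with $r\ge 5$ parts (all positive), and let $i,j$ be integers with $2<i+2<j<r$. If $(\lambda_i,\lambda_{i+1})$ and $(\lambda_j,\lambda_{j+1})$ are both not James, then $H^1(\mathcal{S}_n,S^\lambda)=0$.
   Context: $\mathcal{S}_n$ is the symmetric group, $S^\lambda$ is the Specht module over $k$ in James' convention (the submodule of the permutation module $M^\lambda$ on $\lambda$-tabloids spanned by the polytabloids), and $H^1(\mathcal{S}_n,S^\lambda)=\mathrm{Ext}^1_{k\mathcal{S}_n}(k,S^\lambda)$ with $k$ the trivial module. For a positive integer $x$ with base $p$ expansion $\sum_{i=0}^{\alpha}x_ip^i$, $x_\alpha\neq0$, put $l_p(x)=\alpha$, and let $\mathrm{val}_p(x)$ be the least $i$ with $x_i\ne0$. A two part partition $(a,b)$, $a\ge b>0$, is James if $\mathrm{val}_p(a+1)>l_p(b)$. *)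

theory Defs
  imports
    Complex_Main
    "HOL-Algebra.Sym_Groups"
    "HOL-Algebra.Elementary_Groups"
    "HOL-Combinatorics.Permutations"
    "HOL-Computational_Algebra.Primes"
    "HOL-Library.Function_Algebras"
begin

section \<open>Group cohomology\<close>

text \<open>
  The groups $H^d(G,M) = \mathrm{Ext}^d_{kG}(k,M)$ are those of the complex
  $\mathrm{Hom}_{kG}(P_*,M)$, where $P_*$ is the standard free resolution of the trivial
  module: $P_d$ has $k$-basis $G^{d+1}$ with the diagonal action of $G$. A $kG$-homomorphism
  from $P_d$ to $M$ is given by its values on that basis, i.e. by an equivariant map
  from $G^{d+1}$ to $M$. Tuples are lists, and a cochain is set to 0 outside $G^{d+1}$ so
  that it is determined by its values there. The module is a subset \<open>M\<close> of an ambient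
  additive group, with action \<open>act\<close>. The scalars do not enter the formulas.
\<close>

definition tuples :: "('g, 'x) monoid_scheme \<Rightarrow> nat \<Rightarrow> 'g list set" where
  "tuples G m = {gs. length gs = m \<and> set gs \<subseteq> carrier G}"

definition cochains ::
    "('g, 'x) monoid_scheme \<Rightarrow> 'm::ab_group_add set \<Rightarrow> ('g \<Rightarrow> 'm \<Rightarrow> 'm) \<Rightarrow> nat \<Rightarrow> ('g list \<Rightarrow> 'm) set" where
  "cochains G M act d = {\<phi>.
     (\<forall>gs. gs \<notin> tuples G (d + 1) \<longrightarrow> \<phi> gs = 0) \<and>
     (\<forall>gs \<in> tuples G (d + 1). \<phi> gs \<in> M) \<and>
     (\<forall>g \<in> carrier G. \<forall>gs \<in> tuples G (d + 1). \<phi> (map (\<lambda>h. g \<otimes>\<^bsub>G\<^esub> h) gs) = act g (\<phi> gs))}"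

definition coboundary ::
    "('g, 'x) monoid_scheme \<Rightarrow> nat \<Rightarrow> ('g list \<Rightarrow> 'm::ab_group_add) \<Rightarrow> 'g list \<Rightarrow> 'm" where
  "coboundary G d \<phi> gs =
     (if gs \<in> tuples G (d + 2)
      then \<Sum>l<d + 2. (if even l then \<phi> (take l gs @ drop (l + 1) gs)
                                else - \<phi> (take l gs @ drop (l + 1) gs))
      else 0)"

definition cocycles ::
    "('g, 'x) monoid_scheme \<Rightarrow> 'm::ab_group_add set \<Rightarrow> ('g \<Rightarrow> 'm \<Rightarrow> 'm) \<Rightarrow> nat \<Rightarrow> ('g list \<Rightarrow> 'm) set" where
  "cocycles G M act d = {\<phi> \<in> cochains G M act d. coboundary G d \<phi> = 0}"

definition coboundaries ::
    "('g, 'x) monoid_scheme \<Rightarrow> 'm::ab_group_add set \<Rightarrow> ('g \<Rightarrow> 'm \<Rightarrow> 'm) \<Rightarrow> nat \<Rightarrow> ('g list \<Rightarrow> 'm) set" where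
  "coboundaries G M act d = (if d = 0 then {0} else coboundary G (d - 1) ` cochains G M act (d - 1))"

definition cohomology ::
    "nat \<Rightarrow> ('g, 'x) monoid_scheme \<Rightarrow> 'm::ab_group_add set \<Rightarrow> ('g \<Rightarrow> 'm \<Rightarrow> 'm) \<Rightarrow> ('g list \<Rightarrow> 'm) set monoid" where
  "cohomology d G M act =
     \<lparr>carrier = cocycles G M act d, mult = (+), one = 0\<rparr> Mod coboundaries G M act d"


section \<open>Partitions, tableaux and tabloids\<close>

definition partition_of :: "nat list \<Rightarrow> nat \<Rightarrow> bool" where
  "partition_of lam n \<longleftrightarrow> sorted_wrt (\<ge>) lam \<and> (\<forall>x \<in> set lam. 0 < x) \<and> sum_list lam = n"

text \<open>Parts are counted from 1, as in $\lambda = (\lambda_1,\dots,\lambda_r)$.\<close>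

definition part :: "nat list \<Rightarrow> nat \<Rightarrow> nat" where
  "part lam i = lam ! (i - 1)"

text \<open>Rows and columns of the diagram are counted from 0.\<close>

definition diagram :: "nat list \<Rightarrow> (nat \<times> nat) set" where
  "diagram lam = {(r, c). r < length lam \<and> c < lam ! r}"

definition tableau :: "nat list \<Rightarrow> (nat \<times> nat \<Rightarrow> nat) \<Rightarrow> bool" where
  "tableau lam t \<longleftrightarrow> bij_betw t (diagram lam) {1..sum_list lam}"

text \<open>A tabloid (a tableau up to reordering within rows) is given by the list of the sets
  of entries of its rows.\<close>

definition tabloid_of :: "nat list \<Rightarrow> (nat \<times> nat \<Rightarrow> nat) \<Rightarrow> nat set list" where
  "tabloid_of lam t = map (\<lambda>r. {t (r, c) |c. (r, c) \<in> diagram lam}) [0..<length lam]"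

definition tabloids :: "nat list \<Rightarrow> nat set list set" where
  "tabloids lam = tabloid_of lam ` {t. tableau lam t}"

definition column_stabilizer :: "nat list \<Rightarrow> (nat \<times> nat \<Rightarrow> nat) \<Rightarrow> (nat \<Rightarrow> nat) set" where
  "column_stabilizer lam t = {\<pi>. \<pi> permutes {1..sum_list lam} \<and>
     (\<forall>c. \<pi> ` {t (r, c) |r. (r, c) \<in> diagram lam} = {t (r, c) |r. (r, c) \<in> diagram lam})}"


section \<open>Permutation modules and Specht modules\<close>

text \<open>Formal combinations of tabloids are functions from tabloids to the field,
  with the usual pointwise structure.\<close>

definition scale :: "'k::field \<Rightarrow> (nat set list \<Rightarrow> 'k) \<Rightarrow> nat set list \<Rightarrow> 'k" where
  "scale c f = (\<lambda>T. c * f T)"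

definition basis_vec :: "nat set list \<Rightarrow> nat set list \<Rightarrow> 'k::field" where
  "basis_vec T = (\<lambda>U. if U = T then 1 else 0)"

definition perm_module :: "nat list \<Rightarrow> (nat set list \<Rightarrow> 'k::field) set" where
  "perm_module lam = module.span scale (basis_vec ` tabloids lam)"

text \<open>The linear left action with $\sigma\{t\} = \{\sigma t\}$.\<close>

definition perm_act :: "(nat \<Rightarrow> nat) \<Rightarrow> (nat set list \<Rightarrow> 'k::field) \<Rightarrow> nat set list \<Rightarrow> 'k" where
  "perm_act \<sigma> f = (\<lambda>T. f (map ((`) (inv_into UNIV \<sigma>)) T))"

definition polytabloid :: "nat list \<Rightarrow> (nat \<times> nat \<Rightarrow> nat) \<Rightarrow> nat set list \<Rightarrow> 'k::field" where
  "polytabloid lam t =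
     (\<Sum>\<pi> \<in> column_stabilizer lam t. scale (of_int (sign \<pi>)) (basis_vec (tabloid_of lam (\<pi> \<circ> t))))"

definition specht :: "nat list \<Rightarrow> (nat set list \<Rightarrow> 'k::field) set" where
  "specht lam = module.span scale (polytabloid lam ` {t. tableau lam t})"


section \<open>James pairs\<close>

definition digit :: "nat \<Rightarrow> nat \<Rightarrow> nat \<Rightarrow> nat" where
  "digit p x i = x div p ^ i mod p"

definition len :: "nat \<Rightarrow> nat \<Rightarrow> nat" where
  "len p x = (GREATEST i. digit p x i \<noteq> 0)"

definition val :: "nat \<Rightarrow> nat \<Rightarrow> nat" where
  "val p x = (LEAST i. digit p x i \<noteq> 0)"

text \<open>Meaningful for $a \ge b > 0$ only.\<close>

definition James :: "nat \<Rightarrow> nat \<Rightarrow> nat \<Rightarrow> bool" where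
  "James p a b \<longleftrightarrow> val p (a + 1) > len p b"


section \<open>Basic facts\<close>

lemma vector_space_scale: "vector_space (scale :: 'k::field \<Rightarrow> _)"
  by unfold_locales (auto simp: scale_def fun_eq_iff algebra_simps)

lemma perm_act_basis_vec:
  assumes "\<sigma> permutes {1..sum_list lam}"
  shows "perm_act \<sigma> (basis_vec (tabloid_of lam t) :: _ \<Rightarrow> 'k::field) = basis_vec (tabloid_of lam (\<sigma> \<circ> t))"
proof -
  have b: "bij \<sigma>" using assms permutes_bij by blast
  have s: "map ((`) (inv_into UNIV \<sigma>)) U = V \<longleftrightarrow> U = map ((`) \<sigma>) V" for U V :: "nat set list"
  proof -
    have 1: "map ((`) \<sigma>) (map ((`) (inv_into UNIV \<sigma>)) U) = U"
      using b by (simp add: o_def image_image bij_is_surj surj_f_inv_f)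
    have 2: "map ((`) (inv_into UNIV \<sigma>)) (map ((`) \<sigma>) V) = V"
      using b by (simp add: o_def image_image bij_is_inj)
    show ?thesis using 1 2 by metis
  qed
  have t: "map ((`) \<sigma>) (tabloid_of lam t) = tabloid_of lam (\<sigma> \<circ> t)"
    unfolding tabloid_of_def by (auto simp: o_def)
  show ?thesis unfolding perm_act_def basis_vec_def s t ..
qed

lemma scale_linear_perm_act:
  "perm_act \<sigma> (f + g) = perm_act \<sigma> f + perm_act \<sigma> g"
  "perm_act \<sigma> (scale c f) = scale c (perm_act \<sigma> f)"
  by (auto simp: perm_act_def scale_def fun_eq_iff)

lemma perm_act_sum: "perm_act \<sigma> (\<Sum>x\<in>A. f x) = (\<Sum>x\<in>A. perm_act \<sigma> (f x))"
  by (induction A rule: infinite_finite_induct)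
     (auto simp: scale_linear_perm_act, auto simp: perm_act_def fun_eq_iff)

lemma perm_act_one: "perm_act id f = f"
  by (simp add: perm_act_def)

lemma perm_act_mult:
  assumes "\<sigma> permutes S" "\<tau> permutes S"
  shows "perm_act (\<sigma> \<circ> \<tau>) f = perm_act \<sigma> (perm_act \<tau> f)"
  using assms by (simp add: perm_act_def permutes_bij o_inv_distrib image_comp[symmetric] o_def[of "map _"] fun_eq_iff)
     (simp add: o_def image_comp)

lemma tableau_comp:
  "\<sigma> permutes {1..sum_list lam} \<Longrightarrow> tableau lam t \<Longrightarrow> tableau lam (\<sigma> \<circ> t)"
  unfolding tableau_def using bij_betw_trans permutes_imp_bij by blast

lemma specht_subset_perm_module: "(specht lam :: (_ \<Rightarrow> 'k::field) set) \<subseteq> perm_module lam"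
proof -
  interpret vector_space "scale :: 'k \<Rightarrow> _" by (rule vector_space_scale)
  have "polytabloid lam t \<in> (perm_module lam :: (_ \<Rightarrow> 'k) set)" if "tableau lam t" for t
    unfolding polytabloid_def perm_module_def
    using tableau_comp[OF _ that]
    by (intro span_sum span_scale span_base) (auto simp: tabloids_def column_stabilizer_def)
  then show ?thesis
    unfolding specht_def perm_module_def by (intro span_minimal) auto
qed

lemma perm_act_polytabloid:
  assumes s: "\<sigma> permutes {1..sum_list lam}"
  shows "perm_act \<sigma> (polytabloid lam t :: _ \<Rightarrow> 'k::field) = polytabloid lam (\<sigma> \<circ> t)"
proof -
  let ?i = "inv_into UNIV \<sigma>"
  have b: "bij \<sigma>" and si: "?i permutes {1..sum_list lam}"
    using s permutes_bij permutes_inv by blast+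
  have col: "{(\<sigma> \<circ> t) (r, c) |r. (r, c) \<in> diagram lam} = \<sigma> ` {t (r, c) |r. (r, c) \<in> diagram lam}" for c
    by auto
  have inv: "?i ` \<sigma> ` A = A" "\<sigma> ` ?i ` A = A" for A
    using b by (simp_all add: image_image bij_is_inj bij_is_surj surj_f_inv_f)
  have sg: "sign (\<sigma> \<circ> \<pi> \<circ> ?i) = sign \<pi>" if "\<pi> permutes {1..sum_list lam}" for \<pi>
  proof -
    have "permutation \<sigma>" "permutation \<pi>" "permutation ?i"
      using that s si permutation_permutes by blast+
    then show ?thesis
      by (simp add: sign_compose permutation_compose sign_inverse mult.commute)
  qed
  have "perm_act \<sigma> (polytabloid lam t :: _ \<Rightarrow> 'k) =
     (\<Sum>\<pi> \<in> column_stabilizer lam t. scale (of_int (sign \<pi>)) (basis_vec (tabloid_of lam (\<sigma> \<circ> \<pi> \<circ> t))))"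
    unfolding polytabloid_def perm_act_sum scale_linear_perm_act perm_act_basis_vec[OF s] by (simp add: o_assoc)
  also have "\<dots> = polytabloid lam (\<sigma> \<circ> t)"
    unfolding polytabloid_def
  proof (rule sum.reindex_bij_witness[where i = "\<lambda>\<pi>. ?i \<circ> \<pi> \<circ> \<sigma>" and j = "\<lambda>\<pi>. \<sigma> \<circ> \<pi> \<circ> ?i"])
    fix \<pi> assume p: "\<pi> \<in> column_stabilizer lam t"
    then have pp: "\<pi> permutes {1..sum_list lam}" by (simp add: column_stabilizer_def)
    show "?i \<circ> (\<sigma> \<circ> \<pi> \<circ> ?i) \<circ> \<sigma> = \<pi>"
      using b by (simp add: fun_eq_iff bij_is_inj)
    show "\<sigma> \<circ> \<pi> \<circ> ?i \<in> column_stabilizer lam (\<sigma> \<circ> t)"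
      using p s si unfolding column_stabilizer_def col mem_Collect_eq
      by (simp only: image_comp[symmetric] inv permutes_compose simp_thms)
    have "\<sigma> \<circ> \<pi> \<circ> ?i \<circ> (\<sigma> \<circ> t) = \<sigma> \<circ> \<pi> \<circ> t"
      using b by (simp add: fun_eq_iff bij_is_inj)
    then show "scale (of_int (sign (\<sigma> \<circ> \<pi> \<circ> ?i))) (basis_vec (tabloid_of lam (\<sigma> \<circ> \<pi> \<circ> ?i \<circ> (\<sigma> \<circ> t)))) =
      scale (of_int (sign \<pi>)) (basis_vec (tabloid_of lam (\<sigma> \<circ> \<pi> \<circ> t)) :: _ \<Rightarrow> 'k)"
      using sg[OF pp] by simp
  next
    fix \<pi> assume p: "\<pi> \<in> column_stabilizer lam (\<sigma> \<circ> t)"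
    show "\<sigma> \<circ> (?i \<circ> \<pi> \<circ> \<sigma>) \<circ> ?i = \<pi>"
      using b by (simp add: fun_eq_iff bij_is_surj surj_f_inv_f)
    show "?i \<circ> \<pi> \<circ> \<sigma> \<in> column_stabilizer lam t"
      using p s si unfolding column_stabilizer_def col mem_Collect_eq
      by (simp only: image_comp[symmetric] inv permutes_compose simp_thms)
  qed
  finally show ?thesis .
qed

lemma perm_act_specht:
  assumes "\<sigma> permutes {1..sum_list lam}" "f \<in> (specht lam :: (_ \<Rightarrow> 'k::field) set)"
  shows "perm_act \<sigma> f \<in> specht lam"
proof -
  interpret vector_space "scale :: 'k \<Rightarrow> _" by (rule vector_space_scale)
  show ?thesis using assms(2) unfolding specht_def
  proof (induction rule: span_induct_alt)
    case base
    have "perm_act \<sigma> (0 :: _ \<Rightarrow> 'k) = 0" by (simp add: perm_act_def fun_eq_iff)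
    then show ?case using span_zero by metis
  next
    case (step c x y)
    then obtain t where "tableau lam t" "x = polytabloid lam t" by auto
    then have "perm_act \<sigma> x \<in> polytabloid lam ` {t. tableau lam t}"
      using assms(1) by (simp add: perm_act_polytabloid tableau_comp)
    then show ?case using step(2) unfolding scale_linear_perm_act
      by (blast intro: span_add span_scale span_base)
  qed
qed

lemma cohomology_1_trivial_iff:
  fixes M :: "'m::ab_group_add set"
  assumes G: "group G"
    and M0: "0 \<in> M" and Md: "\<And>x y. x \<in> M \<Longrightarrow> y \<in> M \<Longrightarrow> x - y \<in> M"
    and aM: "\<And>g x. g \<in> carrier G \<Longrightarrow> x \<in> M \<Longrightarrow> act g x \<in> M"
    and ad: "\<And>g x y. g \<in> carrier G \<Longrightarrow> x \<in> M \<Longrightarrow> y \<in> M \<Longrightarrow> act g (x - y) = act g x - act g y"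
    and a1: "\<And>x. x \<in> M \<Longrightarrow> act \<one>\<^bsub>G\<^esub> x = x"
    and am: "\<And>g h x. g \<in> carrier G \<Longrightarrow> h \<in> carrier G \<Longrightarrow> x \<in> M \<Longrightarrow> act (g \<otimes>\<^bsub>G\<^esub> h) x = act g (act h x)"
  shows "trivial_group (cohomology 1 G M act) \<longleftrightarrow>
    (\<forall>f \<in> carrier G \<rightarrow> M.
       (\<forall>g \<in> carrier G. \<forall>h \<in> carrier G. f (g \<otimes>\<^bsub>G\<^esub> h) = f g + act g (f h)) \<longrightarrow>
       (\<exists>m \<in> M. \<forall>g \<in> carrier G. f g = act g m - m))"
proof -
  interpret group G by (rule G)
  have Mn: "- x \<in> M" if "x \<in> M" for x using Md[OF M0 that] by simp
  have Mp: "x + y \<in> M" if "x \<in> M" "y \<in> M" for x y using Md[OF that(1) Mn[OF that(2)]] by simp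
  have a0: "act g 0 = 0" if "g \<in> carrier G" for g using ad[OF that M0 M0] by simp
  have an: "act g (- x) = - act g x" if "g \<in> carrier G" "x \<in> M" for g x
    using ad[OF that(1) M0 that(2)] a0[OF that(1)] by simp
  have ap: "act g (x + y) = act g x + act g y" if "g \<in> carrier G" "x \<in> M" "y \<in> M" for g x y
    using ad[OF that(1,2) Mn[OF that(3)]] an[OF that(1,3)] by simp
  let ?C = "carrier G"
  have T: "gs \<in> tuples G 1 \<longleftrightarrow> (\<exists>a\<in>?C. gs = [a])"
    "gs \<in> tuples G 2 \<longleftrightarrow> (\<exists>a\<in>?C. \<exists>b\<in>?C. gs = [a, b])"
    "gs \<in> tuples G 3 \<longleftrightarrow> (\<exists>a\<in>?C. \<exists>b\<in>?C. \<exists>c\<in>?C. gs = [a, b, c])" for gs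
    by (auto simp: tuples_def numeral_2_eq_2 numeral_3_eq_3 length_Suc_conv)
  have TB: "(\<forall>gs \<in> tuples G 1. P gs) \<longleftrightarrow> (\<forall>a\<in>?C. P [a])"
    "(\<forall>gs \<in> tuples G 2. P gs) \<longleftrightarrow> (\<forall>a\<in>?C. \<forall>b\<in>?C. P [a, b])"
    "(\<forall>gs \<in> tuples G 3. P gs) \<longleftrightarrow> (\<forall>a\<in>?C. \<forall>b\<in>?C. \<forall>c\<in>?C. P [a, b, c])" for P
    unfolding Ball_def T by blast+
  have d0: "coboundary G 0 \<phi> gs = (if gs \<in> tuples G 2 then \<phi> [gs ! 1] - \<phi> [gs ! 0] else 0)"
    for \<phi> :: "'a list \<Rightarrow> 'm" and gs
    by (auto simp: coboundary_def T(2)[unfolded numeral_2_eq_2] numeral_2_eq_2)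
  have d1: "coboundary G 1 \<phi> gs = (if gs \<in> tuples G 3
      then \<phi> [gs ! 1, gs ! 2] - \<phi> [gs ! 0, gs ! 2] + \<phi> [gs ! 0, gs ! 1] else 0)"
    for \<phi> :: "'a list \<Rightarrow> 'm" and gs
    by (auto simp: coboundary_def T(3)[unfolded numeral_3_eq_3] numeral_2_eq_2 numeral_3_eq_3)
  have C0: "\<phi> \<in> cochains G M act 0 \<longleftrightarrow> (\<forall>gs. gs \<notin> tuples G 1 \<longrightarrow> \<phi> gs = 0) \<and>
      (\<forall>a\<in>?C. \<phi> [a] \<in> M) \<and> (\<forall>g\<in>?C. \<forall>a\<in>?C. \<phi> [g \<otimes>\<^bsub>G\<^esub> a] = act g (\<phi> [a]))" for \<phi>
    by (simp add: cochains_def TB[unfolded One_nat_def])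
  have C1: "\<phi> \<in> cochains G M act 1 \<longleftrightarrow> (\<forall>gs. gs \<notin> tuples G 2 \<longrightarrow> \<phi> gs = 0) \<and>
      (\<forall>a\<in>?C. \<forall>b\<in>?C. \<phi> [a, b] \<in> M) \<and>
      (\<forall>g\<in>?C. \<forall>a\<in>?C. \<forall>b\<in>?C. \<phi> [g \<otimes>\<^bsub>G\<^esub> a, g \<otimes>\<^bsub>G\<^esub> b] = act g (\<phi> [a, b]))" for \<phi>
    by (simp add: cochains_def TB[unfolded numeral_2_eq_2] numeral_2_eq_2)
  note One_nat_def [simp del]
  let ?Z = "cocycles G M act 1" and ?B = "coboundaries G M act 1"
  have Z: "\<phi> \<in> ?Z \<longleftrightarrow> \<phi> \<in> cochains G M act 1 \<and>
      (\<forall>a\<in>?C. \<forall>b\<in>?C. \<forall>c\<in>?C. \<phi> [a, c] = \<phi> [a, b] + \<phi> [b, c])" for \<phi>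
  proof -
    have e: "x - y + z = 0 \<longleftrightarrow> y = z + x" for x y z :: 'm
      by (metis add.commute add_diff_eq eq_iff_diff_eq_0)
    have "coboundary G 1 \<phi> = 0 \<longleftrightarrow>
        (\<forall>gs \<in> tuples G 3. \<phi> [gs ! 1, gs ! 2] - \<phi> [gs ! 0, gs ! 2] + \<phi> [gs ! 0, gs ! 1] = 0)"
      unfolding fun_eq_iff d1 by auto
    then show ?thesis unfolding cocycles_def TB(3) e by simp
  qed
  have Zc: "\<phi> [a, c] = \<phi> [a, b] + \<phi> [b, c]"
    if "\<phi> \<in> ?Z" "a \<in> ?C" "b \<in> ?C" "c \<in> ?C" for \<phi> a b c
    using that unfolding Z by blast
  have ZC: "\<phi> \<in> cochains G M act 1" if "\<phi> \<in> ?Z" for \<phi>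
    using that unfolding Z by blast
  have B: "?B = coboundary G 0 ` cochains G M act 0" by (simp add: coboundaries_def)
  have BZ: "?B \<subseteq> ?Z"
    unfolding B by (auto simp: Z C1 C0 d0 T(2) Md ad)
  let ?K = "\<lparr>carrier = ?Z, mult = (+), one = 0\<rparr>"
  have Z0: "0 \<in> ?Z" by (auto simp: Z C1 M0 a0)
  have Zp: "\<phi> + \<psi> \<in> ?Z" if "\<phi> \<in> ?Z" "\<psi> \<in> ?Z" for \<phi> \<psi>
  proof -
    have "(\<phi> + \<psi>) [a, c] = (\<phi> + \<psi>) [a, b] + (\<phi> + \<psi>) [b, c]"
      if "a \<in> ?C" "b \<in> ?C" "c \<in> ?C" for a b c
      using Zc[OF \<open>\<phi> \<in> ?Z\<close> that] Zc[OF \<open>\<psi> \<in> ?Z\<close> that] by (simp add: add_ac)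
    moreover have "\<phi> + \<psi> \<in> cochains G M act 1"
      using ZC[OF that(1)] ZC[OF that(2)] unfolding C1 by (simp add: Mp ap)
    ultimately show ?thesis unfolding Z by blast
  qed
  have Zn: "- \<phi> \<in> ?Z" if "\<phi> \<in> ?Z" for \<phi>
  proof -
    have "(- \<phi>) [a, c] = (- \<phi>) [a, b] + (- \<phi>) [b, c]"
      if "a \<in> ?C" "b \<in> ?C" "c \<in> ?C" for a b c
      using Zc[OF \<open>\<phi> \<in> ?Z\<close> that] by simp
    moreover have "- \<phi> \<in> cochains G M act 1"
      using ZC[OF that] unfolding C1 by (simp add: Mn an)
    ultimately show ?thesis unfolding Z by blast
  qed
  have K: "comm_group ?K"
    by (rule comm_groupI) (auto simp: Z0 Zp add_ac intro: bexI[OF _ Zn])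
  interpret K: comm_group ?K by (rule K)
  have Kinv: "inv\<^bsub>?K\<^esub> \<phi> = - \<phi>" if "\<phi> \<in> ?Z" for \<phi>
    using that Zn by (intro K.inv_equality) auto
  have subB: "subgroup ?B ?K"
  proof (rule K.subgroupI)
    show "?B \<subseteq> carrier ?K" using BZ by simp
    have "0 \<in> cochains G M act 0" by (auto simp: C0 M0 a0)
    then show "?B \<noteq> {}" unfolding B by blast
  next
    fix x assume x: "x \<in> ?B"
    then obtain \<psi> where p: "\<psi> \<in> cochains G M act 0" "x = coboundary G 0 \<psi>" unfolding B by blast
    have "- \<psi> \<in> cochains G M act 0" using p(1) by (auto simp: C0 Mn an)
    moreover have "- x = coboundary G 0 (- \<psi>)" unfolding p(2) by (auto simp: d0 fun_eq_iff)
    ultimately have "- x \<in> ?B" unfolding B by blast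
    then show "inv\<^bsub>?K\<^esub> x \<in> ?B" using Kinv x BZ by auto
  next
    fix x y assume "x \<in> ?B" "y \<in> ?B"
    then obtain \<psi> \<chi> where p: "\<psi> \<in> cochains G M act 0" "x = coboundary G 0 \<psi>"
        "\<chi> \<in> cochains G M act 0" "y = coboundary G 0 \<chi>" unfolding B by blast
    have "\<psi> + \<chi> \<in> cochains G M act 0" using p(1,3) by (auto simp: C0 Mp ap)
    moreover have "x + y = coboundary G 0 (\<psi> + \<chi>)"
      unfolding p(2,4) by (auto simp: d0 fun_eq_iff algebra_simps)
    ultimately have "x + y \<in> ?B" unfolding B by blast
    then show "x \<otimes>\<^bsub>?K\<^esub> y \<in> ?B" by simp
  qed
  then have nB: "?B \<lhd> ?K" by (rule K.subgroup_imp_normal)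
  have "trivial_group (cohomology 1 G M act) \<longleftrightarrow> (\<forall>\<phi>\<in>?Z. ?B #>\<^bsub>?K\<^esub> \<phi> = ?B)"
    using normal.factorgroup_is_group[OF nB] Z0
    by (auto simp: trivial_group_def cohomology_def carrier_FactGroup)
  also have "\<dots> \<longleftrightarrow> ?Z \<subseteq> ?B"
  proof -
    have "?B #>\<^bsub>?K\<^esub> \<phi> = ?B \<longleftrightarrow> \<phi> \<in> ?B" if "\<phi> \<in> ?Z" for \<phi>
      using K.coset_join1[OF _ _ subB, of \<phi>] K.coset_join2[OF _ subB, of \<phi>] that BZ by auto
    then show ?thesis by auto
  qed
  also have "\<dots> \<longleftrightarrow> (\<forall>f \<in> ?C \<rightarrow> M.
       (\<forall>g \<in> ?C. \<forall>h \<in> ?C. f (g \<otimes>\<^bsub>G\<^esub> h) = f g + act g (f h)) \<longrightarrow>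
       (\<exists>m \<in> M. \<forall>g \<in> ?C. f g = act g m - m))" (is "_ \<longleftrightarrow> ?R")
  proof
    assume ZB: "?Z \<subseteq> ?B"
    show ?R
    proof (intro ballI impI)
      fix f assume f: "f \<in> ?C \<rightarrow> M"
        and fc: "\<forall>g \<in> ?C. \<forall>h \<in> ?C. f (g \<otimes>\<^bsub>G\<^esub> h) = f g + act g (f h)"
      define \<psi> where "\<psi> = (\<lambda>gs. if gs \<in> tuples G 2 then f (gs ! 1) - f (gs ! 0) else 0)"
      have fM: "f a \<in> M" if "a \<in> ?C" for a using f that by auto
      have "\<psi> \<in> ?Z"
        by (auto simp: Z C1 \<psi>_def T(2) Md fM fc ad)
      with ZB obtain \<chi> where c: "\<chi> \<in> cochains G M act 0" "\<psi> = coboundary G 0 \<chi>"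
        unfolding B by blast
      let ?m = "\<chi> [\<one>\<^bsub>G\<^esub>]"
      have f1: "f \<one>\<^bsub>G\<^esub> = 0"
        using fc[rule_format, of "\<one>\<^bsub>G\<^esub>" "\<one>\<^bsub>G\<^esub>"] a1[OF fM[of "\<one>\<^bsub>G\<^esub>"]] by simp
      have "f g = act g ?m - ?m" if g: "g \<in> ?C" for g
      proof -
        have "\<psi> [\<one>\<^bsub>G\<^esub>, g] = \<chi> [g] - ?m" using c(2) g by (simp add: d0 T(2))
        moreover have "\<chi> [g] = act g ?m" using c(1) g unfolding C0 by (metis one_closed r_one)
        ultimately show ?thesis using g f1 by (simp add: \<psi>_def T(2))
      qed
      moreover have "?m \<in> M" using c(1) unfolding C0 by simp
      ultimately show "\<exists>m \<in> M. \<forall>g \<in> ?C. f g = act g m - m" by blast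
    qed
  next
    assume R: ?R
    show "?Z \<subseteq> ?B"
    proof
      fix \<phi> assume p: "\<phi> \<in> ?Z"
      note cc = Zc[OF p]
      have pM: "\<phi> [a, b] \<in> M" if "a \<in> ?C" "b \<in> ?C" for a b
        using p that unfolding Z C1 by blast
      have pe: "\<phi> [g \<otimes>\<^bsub>G\<^esub> a, g \<otimes>\<^bsub>G\<^esub> b] = act g (\<phi> [a, b])" if "g \<in> ?C" "a \<in> ?C" "b \<in> ?C" for g a b
        using p that unfolding Z C1 by blast
      let ?f = "\<lambda>g. \<phi> [\<one>\<^bsub>G\<^esub>, g]"
      have "?f (g \<otimes>\<^bsub>G\<^esub> h) = ?f g + act g (?f h)" if "g \<in> ?C" "h \<in> ?C" for g h
        using cc[of "\<one>\<^bsub>G\<^esub>" g "g \<otimes>\<^bsub>G\<^esub> h"] pe[of g "\<one>\<^bsub>G\<^esub>" h] that by simp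
      moreover have "?f \<in> ?C \<rightarrow> M" using pM by auto
      ultimately obtain m where m: "m \<in> M" "\<And>g. g \<in> ?C \<Longrightarrow> ?f g = act g m - m"
        using R[rule_format, of ?f] by blast
      define \<psi> where "\<psi> = (\<lambda>gs. if gs \<in> tuples G 1 then act (gs ! 0) m else 0)"
      have "\<psi> \<in> cochains G M act 0"
        using m(1) by (auto simp: C0 \<psi>_def T(1) aM am)
      moreover have "\<phi> = coboundary G 0 \<psi>"
      proof
        fix gs show "\<phi> gs = coboundary G 0 \<psi> gs"
        proof (cases "gs \<in> tuples G 2")
          case True
          then obtain a b where ab: "a \<in> ?C" "b \<in> ?C" "gs = [a, b]" using T(2) by blast
          have "\<phi> [a, b] = ?f b - ?f a" using cc[of "\<one>\<^bsub>G\<^esub>" a b] ab by simp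
          then show ?thesis using m(2) ab True by (simp add: d0 \<psi>_def T(1))
        next
          case False
          then show ?thesis using p unfolding Z C1 by (simp add: d0)
        qed
      qed
      ultimately show "\<phi> \<in> ?B" unfolding B by blast
    qed
  qed
  finally show ?thesis .
qed

lemma cohomology_1_specht_trivial_iff:
  fixes lam :: "nat list"
  defines "n \<equiv> sum_list lam" and "S \<equiv> specht lam :: (nat set list \<Rightarrow> 'k::field) set"
  shows "trivial_group (cohomology 1 (sym_group n) S perm_act) \<longleftrightarrow>
    (\<forall>f \<in> carrier (sym_group n) \<rightarrow> S.
       (\<forall>g \<in> carrier (sym_group n). \<forall>h \<in> carrier (sym_group n). f (g \<circ> h) = f g + perm_act g (f h)) \<longrightarrow>
       (\<exists>m \<in> S. \<forall>g \<in> carrier (sym_group n). f g = perm_act g m - m))"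
proof -
  interpret vector_space "scale :: 'k \<Rightarrow> _" by (rule vector_space_scale)
  have diff: "perm_act g (x - y) = perm_act g x - perm_act g y" for g and x y :: "nat set list \<Rightarrow> 'k"
    by (simp add: perm_act_def fun_eq_iff)
  have one: "perm_act \<one>\<^bsub>sym_group n\<^esub> x = x" for x :: "nat set list \<Rightarrow> 'k"
    by (simp add: sym_group_one perm_act_one)
  have mult: "perm_act (g \<otimes>\<^bsub>sym_group n\<^esub> h) x = perm_act g (perm_act h x)"
    if "g \<in> carrier (sym_group n)" "h \<in> carrier (sym_group n)" for g h and x :: "nat set list \<Rightarrow> 'k"
    using that unfolding sym_group_carrier sym_group_mult by (rule perm_act_mult)
  have closed: "perm_act g x \<in> S" if "g \<in> carrier (sym_group n)" "x \<in> S" for g x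
    using that unfolding sym_group_carrier S_def n_def by (rule perm_act_specht)
  have "0 \<in> S" "\<And>x y. x \<in> S \<Longrightarrow> y \<in> S \<Longrightarrow> x - y \<in> S"
    unfolding S_def specht_def by (rule span_zero, rule span_diff)
  then show ?thesis
    unfolding sym_group_mult[of n, symmetric]
    by (intro cohomology_1_trivial_iff sym_group_is_group closed diff one mult)
qed

end

theory Submission
  imports Defs
begin

text \<open>
  The proof compares three modules: the Specht module, the permutation module $M^\lambda$ that
  contains it, and the targets of the maps $\psi_{l,d}$ out of $M^\lambda$ that lift $d$ entries
  of a tabloid from row $l+1$ to row $l$.

  The first cohomology of $M^\lambda$ vanishes, because $M^\lambda$ is induced from a Young
  subgroup, which is generated by elements of order 2 and so has no nonzero homomorphism into a
  field of odd characteristic (\<open>perm_module_cocycle_is_coboundary\<close>). A cocycle with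
  values in $S^\lambda$ thus has the form $g \mapsto gu - u$ with $u \in M^\lambda$, and it
  remains to move $u$ into $S^\lambda$ by subtracting an invariant element, that is, a multiple
  $\alpha\omega$ of the sum $\omega$ of all tabloids.

  Membership in $S^\lambda$ is decided by James' kernel intersection theorem: $S^\lambda$ is the
  common kernel of all $\psi_{l,d}$ with $d > 0$ (\<open>specht_highest_weight\<close> and
  \<open>highest_weight_in_specht\<close>). One inclusion is a sign cancellation. For the other
  one, the leading tabloid of an element of the common kernel, with respect to a suitable order,
  must be standard. Otherwise a Garnir-type relation, which follows from the kernel conditions
  by inclusion and exclusion (\<open>garnir_sum_zero\<close>), expresses its coefficient by
  coefficients at larger tabloids. Subtracting polytabloids of standard tableaux then reduces
  the element to 0.

  As $gu - u$ lies in $S^\lambda$, each $\psi_{l,d}(u)$ is invariant, hence a scalar $A_{l,d}$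
  times the sum of all tabloids of the new shape. Likewise $\psi_{l,d}(\omega)$ has the scalar
  $B_{l,d} = \binom{\lambda_l + d}{d}$. Maps $\psi$ that belong to disjoint pairs of rows
  commute, which gives $A_{l,d} B_{m,e} = A_{m,e} B_{l,d}$ whenever $l$ and $m$ differ by at
  least 2. A pair $(\lambda_i, \lambda_{i+1})$ that is not James provides some $B_{i,c} \neq 0$
  (\<open>not_James_binomial\<close>), so that $A_{l,d} = \alpha B_{l,d}$ for all $l$ at
  distance at least 2 from $i$, where $\alpha = A_{i,c} / B_{i,c}$. A second such pair $j > i +
  2$ takes care of the remaining $l$, with the same $\alpha$. Therefore all $\psi_{l,d}$ kill $u
  - \alpha\omega$, which then lies in $S^\lambda$.
\<close>

section \<open>Tabloids as ordered set partitions\<close>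

lemma tabloid_of_nth:
  "r < length mu \<Longrightarrow> tabloid_of mu t ! r = (\<lambda>c. t (r, c)) ` {..<mu ! r}"
  unfolding tabloid_of_def diagram_def by auto

lemma length_tabloid_of [simp]: "length (tabloid_of mu t) = length mu"
  by (simp add: tabloid_of_def)

lemma map_image_tabloid_of: "map ((`) g) (tabloid_of mu t) = tabloid_of mu (g \<circ> t)"
  by (rule nth_equalityI) (auto simp: tabloid_of_nth)

text \<open>
  Listing each row in increasing order picks a representative tableau of a tabloid. It is the
  representative whose columns decide below whether the tabloid is standard.
\<close>

definition row_tableau :: "nat set list \<Rightarrow> nat \<times> nat \<Rightarrow> nat" where
  "row_tableau T = (\<lambda>(r, c). sorted_list_of_set (T ! r) ! c)"

text \<open>
  The intrinsic description of \<open>tabloids\<close>: no tableau is mentioned, so moving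
  entries between rows can be checked row by row. It makes sense for every list of row lengths,
  not only for partitions, and the shapes met below are often not partitions.
\<close>

definition set_partition :: "nat list \<Rightarrow> nat set list \<Rightarrow> bool" where
  "set_partition mu T \<longleftrightarrow> length T = length mu \<and> (\<forall>r<length mu. card (T ! r) = mu ! r) \<and>
     (\<forall>r<length mu. \<forall>s<length mu. r \<noteq> s \<longrightarrow> T ! r \<inter> T ! s = {}) \<and>
     \<Union>(set T) = {1..sum_list mu}"

lemma set_partition_finite: "set_partition mu T \<Longrightarrow> r < length mu \<Longrightarrow> finite (T ! r)"
  unfolding set_partition_def by (metis Union_upper finite_atLeastAtMost finite_subset nth_mem)

lemma row_tableau:
  assumes "set_partition mu T"
  shows "tableau mu (row_tableau T)" and "tabloid_of mu (row_tableau T) = T"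
proof -
  have fin: "finite (T ! r)" if "r < length mu" for r
    using assms that by (rule set_partition_finite)
  have len: "length T = length mu" and card: "card (T ! r) = mu ! r" if "r < length mu" for r
    using assms that by (auto simp: set_partition_def)
  have disj: "r = s" if "x \<in> T ! r" "x \<in> T ! s" "r < length mu" "s < length mu" for r s x
    using assms that unfolding set_partition_def by blast
  have un: "\<Union>(set T) = {1..sum_list mu}" and lenT: "length T = length mu"
    using assms by (auto simp: set_partition_def)
  have row: "(\<lambda>c. row_tableau T (r, c)) ` {..<mu ! r} = T ! r" if r: "r < length mu" for r
  proof -
    have "set (sorted_list_of_set (T ! r)) = T ! r" "length (sorted_list_of_set (T ! r)) = mu ! r"
      using fin[OF r] card[OF r] by auto
    then show ?thesis unfolding row_tableau_def by (auto simp: set_conv_nth) 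
  qed
  show T: "tabloid_of mu (row_tableau T) = T"
    by (rule nth_equalityI) (auto simp: tabloid_of_nth row lenT)
  have in_row: "row_tableau T (r, c) \<in> T ! r" if "r < length mu" "c < mu ! r" for r c
    using row[OF that(1)] that(2) by blast
  show "tableau mu (row_tableau T)"
    unfolding tableau_def
  proof (rule bij_betw_imageI)
    show "inj_on (row_tableau T) (diagram mu)"
    proof (rule inj_onI, clarsimp simp: diagram_def)
      fix r c s d
      assume h: "row_tableau T (r, c) = row_tableau T (s, d)" "r < length mu" "c < mu ! r"
        "s < length mu" "d < mu ! s"
      then have rs: "r = s" using in_row disj by metis
      moreover have "c = d"
        using h card[of r] unfolding rs row_tableau_def by (simp add: nth_eq_iff_index_eq)
      ultimately show "r = s \<and> c = d" by simp
    qed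
    have "row_tableau T ` diagram mu = (\<Union>r<length mu. (\<lambda>c. row_tableau T (r, c)) ` {..<mu ! r})"
      unfolding diagram_def by auto
    also have "\<dots> = (\<Union>r<length mu. T ! r)" using row by auto
    also have "\<dots> = \<Union>(set T)" unfolding lenT[symmetric] set_conv_nth by auto
    finally show "row_tableau T ` diagram mu = {1..sum_list mu}" using un by simp
  qed
qed

lemma tabloids_iff: "T \<in> tabloids mu \<longleftrightarrow> set_partition mu T"
proof
  assume "T \<in> tabloids mu"
  then obtain t where t: "tableau mu t" and T: "T = tabloid_of mu t" by (auto simp: tabloids_def)
  have inj: "inj_on t (diagram mu)" and im: "t ` diagram mu = {1..sum_list mu}"
    using t unfolding tableau_def bij_betw_def by auto
  have "card (T ! r) = mu ! r" if "r < length mu" for r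
  proof -
    have "inj_on (\<lambda>c. t (r, c)) {..<mu ! r}"
      using that by (auto intro!: inj_onI dest!: inj_onD[OF inj] simp: diagram_def)
    then show ?thesis using that by (simp add: T tabloid_of_nth card_image)
  qed
  moreover have "T ! r \<inter> T ! s = {}" if "r < length mu" "s < length mu" "r \<noteq> s" for r s
    using that by (auto simp: T tabloid_of_nth diagram_def dest!: inj_onD[OF inj])
  moreover have "\<Union>(set T) = t ` diagram mu"
    unfolding T tabloid_of_def by (auto simp: diagram_def)
  ultimately show "set_partition mu T" unfolding set_partition_def im by (simp add: T)
next
  assume "set_partition mu T"
  from row_tableau[OF this] show "T \<in> tabloids mu"
    unfolding tabloids_def by (metis (mono_tags) image_eqI mem_Collect_eq)
qed

lemma map_image_tabloids:
  "g permutes {1..sum_list mu} \<Longrightarrow> T \<in> tabloids mu \<Longrightarrow> map ((`) g) T \<in> tabloids mu"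
  unfolding tabloids_def by (auto simp: map_image_tabloid_of tableau_comp)

text \<open>
  Two tableaux of one shape differ by the permutation that carries the entry of each box to the
  entry of the same box.
\<close>

lemma tabloids_transitive:
  assumes "T \<in> tabloids mu" "T' \<in> tabloids mu"
  obtains g where "g permutes {1..sum_list mu}" "map ((`) g) T = T'"
proof -
  obtain t t' where t: "tableau mu t" "T = tabloid_of mu t" and t': "tableau mu t'" "T' = tabloid_of mu t'"
    using assms by (auto simp: tabloids_def)
  let ?n = "{1..sum_list mu}"
  define h where "h = t' \<circ> inv_into (diagram mu) t"
  define g where "g = (\<lambda>x. if x \<in> ?n then h x else x)"
  have "bij_betw h ?n ?n"
    using t(1) t'(1) unfolding tableau_def h_def by (metis bij_betw_inv_into bij_betw_trans)
  then have "bij_betw g ?n ?n" by (rule bij_betw_cong[THEN iffD1, rotated]) (simp add: g_def)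
  then have g: "g permutes ?n" by (rule bij_imp_permutes) (auto simp: g_def)
  have inj: "inj_on t (diagram mu)" and tn: "t x \<in> ?n" if "x \<in> diagram mu" for x
    using t(1) that unfolding tableau_def bij_betw_def by auto
  have "(g \<circ> t) x = t' x" if "x \<in> diagram mu" for x
    using that tn[OF that] inj[OF that] by (simp add: g_def h_def)
  then have "tabloid_of mu (g \<circ> t) = T'"
    unfolding t'(2) by (intro nth_equalityI) (auto simp: tabloid_of_nth diagram_def)
  then show ?thesis using that g t(2) by (simp add: map_image_tabloid_of)
qed

lemma tabloids_nonempty: "tabloids mu \<noteq> {}"
proof -
  have "finite (diagram mu)" "card (diagram mu) = sum_list mu"
  proof -
    have d: "diagram mu = (SIGMA r:{..<length mu}. {..<mu ! r})" by (auto simp: diagram_def)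
    show "finite (diagram mu)" unfolding d by auto
    show "card (diagram mu) = sum_list mu" unfolding d
      by (simp add: sum_list_sum_nth lessThan_atLeast0)
  qed
  then obtain t where "bij_betw t (diagram mu) {1..sum_list mu}"
    by (metis card_atLeastAtMost diff_Suc_1 finite_atLeastAtMost finite_same_card_bij)
  then show ?thesis by (auto simp: tabloids_def tableau_def)
qed

lemma finite_tabloids: "finite (tabloids mu)"
proof (rule finite_subset)
  show "tabloids mu \<subseteq> {T. set T \<subseteq> Pow {1..sum_list mu} \<and> length T = length mu}"
  proof
    fix T assume "T \<in> tabloids mu"
    then have "length T = length mu" "\<Union>(set T) = {1..sum_list mu}"
      unfolding tabloids_iff set_partition_def by blast+
    then show "T \<in> {T. set T \<subseteq> Pow {1..sum_list mu} \<and> length T = length mu}"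
      by (metis (mono_tags) Pow_iff Union_upper mem_Collect_eq subsetI)
  qed
qed (simp add: finite_lists_length_eq)

lemma sum_fun_apply: "(\<Sum>x\<in>A. h x) T = (\<Sum>x\<in>A. h x T)"
  by (induction A rule: infinite_finite_induct) auto

lemma perm_module_iff:
  "(u :: _ \<Rightarrow> 'k::field) \<in> perm_module lam \<longleftrightarrow> (\<forall>T. u T \<noteq> 0 \<longrightarrow> T \<in> tabloids lam)"
proof
  interpret vector_space "scale :: 'k \<Rightarrow> _" by (rule vector_space_scale)
  show "\<forall>T. u T \<noteq> 0 \<longrightarrow> T \<in> tabloids lam" if "u \<in> perm_module lam"
    using that unfolding perm_module_def
    by (induction rule: span_induct_alt) (auto simp: basis_vec_def scale_def split: if_splits)
  assume s: "\<forall>T. u T \<noteq> 0 \<longrightarrow> T \<in> tabloids lam"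
  have "u = (\<Sum>T\<in>tabloids lam. scale (u T) (basis_vec T))"
  proof
    fix T
    show "u T = (\<Sum>T\<in>tabloids lam. scale (u T) (basis_vec T)) T"
      using s by (auto simp: sum_fun_apply scale_def basis_vec_def finite_tabloids if_distrib sum.delta cong: if_cong)
  qed
  also have "\<dots> \<in> perm_module lam"
    unfolding perm_module_def by (intro span_sum span_scale span_base) auto
  finally show "u \<in> perm_module lam" .
qed

section \<open>Raising operators\<close>

text \<open>
  The map $\psi_{i,d}: M^\mu \to M^{\mu'}$ sends a tabloid to the sum of all tabloids obtained
  by lifting $d$ entries from row $i+1$ to row $i$; on the sum of all permutation modules it is
  the divided power $e_i^{(d)}$ of a raising operator of $\mathfrak{gl}_r$. As elements of
  permutation modules are functions, its value at a tabloid $V$ is a sum over the tabloids from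
  which $V$ arises, that is, over the ways to lower $d$ entries again.
\<close>

definition lower_entries :: "nat \<Rightarrow> nat set \<Rightarrow> nat set list \<Rightarrow> nat set list" where
  "lower_entries i D V = V[i := V ! i - D, Suc i := V ! Suc i \<union> D]"

definition lift_entries :: "nat \<Rightarrow> nat set \<Rightarrow> nat set list \<Rightarrow> nat set list" where
  "lift_entries i D T = T[i := T ! i \<union> D, Suc i := T ! Suc i - D]"

definition raise :: "nat \<Rightarrow> nat \<Rightarrow> (nat set list \<Rightarrow> 'k::field) \<Rightarrow> nat set list \<Rightarrow> 'k" where
  "raise i d u V = (\<Sum>D | D \<subseteq> V ! i \<and> card D = d. u (lower_entries i D V))"

definition raised_shape :: "nat \<Rightarrow> nat \<Rightarrow> nat list \<Rightarrow> nat list" where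
  "raised_shape i d mu = mu[i := mu ! i + d, Suc i := mu ! Suc i - d]"

lemma length_entries [simp]:
  "length (lower_entries i D V) = length V" "length (lift_entries i D V) = length V"
  "length (raised_shape i d mu) = length mu"
  by (simp_all add: lower_entries_def lift_entries_def raised_shape_def)

lemma nth_lower_entries:
  "Suc i < length V \<Longrightarrow> lower_entries i D V ! r =
     (if r = i then V ! i - D else if r = Suc i then V ! Suc i \<union> D else V ! r)"
  by (auto simp: lower_entries_def nth_list_update)

lemma nth_lift_entries:
  "Suc i < length V \<Longrightarrow> lift_entries i D V ! r =
     (if r = i then V ! i \<union> D else if r = Suc i then V ! Suc i - D else V ! r)"
  by (auto simp: lift_entries_def nth_list_update)

lemma nth_raised_shape:
  "Suc i < length mu \<Longrightarrow> raised_shape i d mu ! r =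
     (if r = i then mu ! i + d else if r = Suc i then mu ! Suc i - d else mu ! r)"
  by (auto simp: raised_shape_def nth_list_update)

lemma lift_lower_entries:
  "Suc i < length V \<Longrightarrow> D \<subseteq> V ! i \<Longrightarrow> V ! i \<inter> V ! Suc i = {} \<Longrightarrow>
     lift_entries i D (lower_entries i D V) = V"
  by (rule nth_equalityI) (auto simp: nth_lower_entries nth_lift_entries)

lemma lower_lift_entries:
  "Suc i < length T \<Longrightarrow> D \<subseteq> T ! Suc i \<Longrightarrow> T ! i \<inter> T ! Suc i = {} \<Longrightarrow>
     lower_entries i D (lift_entries i D T) = T"
  by (rule nth_equalityI) (auto simp: nth_lower_entries nth_lift_entries)

lemma sum_list_raised_shape:
  assumes "Suc i < length mu" "d \<le> mu ! Suc i"
  shows "sum_list (raised_shape i d mu) = sum_list mu"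
proof -
  have split: "(\<Sum>r<length mu. f r) = f i + (f (Suc i) + (\<Sum>r\<in>{..<length mu} - {i} - {Suc i}. f r))"
    for f :: "nat \<Rightarrow> nat"
  proof -
    have "(\<Sum>r<length mu. f r) = f i + (\<Sum>r\<in>{..<length mu} - {i}. f r)"
      using assms(1) by (intro sum.remove) auto
    also have "(\<Sum>r\<in>{..<length mu} - {i}. f r) = f (Suc i) + (\<Sum>r\<in>{..<length mu} - {i} - {Suc i}. f r)"
      using assms(1) by (intro sum.remove) auto
    finally show ?thesis .
  qed
  have "(\<Sum>r\<in>{..<length mu} - {i} - {Suc i}. raised_shape i d mu ! r)
      = (\<Sum>r\<in>{..<length mu} - {i} - {Suc i}. mu ! r)"
    using assms(1) by (intro sum.cong) (auto simp: nth_raised_shape)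
  moreover have "raised_shape i d mu ! i + raised_shape i d mu ! Suc i = mu ! i + mu ! Suc i"
    using assms by (simp add: nth_raised_shape)
  ultimately have "(\<Sum>r<length mu. raised_shape i d mu ! r) = (\<Sum>r<length mu. mu ! r)"
    unfolding split by simp
  then show ?thesis by (simp add: sum_list_sum_nth lessThan_atLeast0)
qed

lemma Union_set_nth: "\<Union>(set T) = (\<Union>r<length T. T ! r)"
  unfolding set_conv_nth by auto

lemma lift_entries_tabloids:
  assumes i: "Suc i < length mu" and T: "T \<in> tabloids mu" and D: "D \<subseteq> T ! Suc i" "card D = d"
  shows "lift_entries i D T \<in> tabloids (raised_shape i d mu)" and "d \<le> mu ! Suc i"
proof -
  have sp: "set_partition mu T" using T by (simp add: tabloids_iff)
  have len: "length T = length mu" and card: "\<And>r. r < length mu \<Longrightarrow> card (T ! r) = mu ! r"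
    and disj: "\<And>r s. r < length mu \<Longrightarrow> s < length mu \<Longrightarrow> r \<noteq> s \<Longrightarrow> T ! r \<inter> T ! s = {}"
    and un: "\<Union>(set T) = {1..sum_list mu}"
    using sp unfolding set_partition_def by auto
  have fin: "finite (T ! r)" if "r < length mu" for r using sp that by (rule set_partition_finite)
  have finD: "finite D" using D(1) fin[OF i] by (rule finite_subset)
  show d: "d \<le> mu ! Suc i" using D card[OF i] card_mono[OF fin[OF i] D(1)] by simp
  have il: "Suc i < length T" using i len by simp
  have dj: "T ! i \<inter> D = {}" using D(1) disj[of i "Suc i"] i by auto
  have cards: "card (lift_entries i D T ! r) = raised_shape i d mu ! r" if "r < length mu" for r
    using that D(2) finD dj i card fin
    by (auto simp: nth_lift_entries[OF il] nth_raised_shape[OF i] card_Un_disjoint card_Diff_subset D(1))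
  have mem: "x \<in> lift_entries i D T ! r \<longleftrightarrow> (if x \<in> D then r = i else x \<in> T ! r)"
    if "r < length mu" for x r
  proof (cases "x \<in> D")
    case True
    then have "x \<in> T ! (Suc i)" using D(1) by blast
    then have "x \<in> T ! r \<Longrightarrow> r = Suc i" using disj[OF that, of "Suc i"] i by fastforce
    then show ?thesis using True unfolding nth_lift_entries[OF il] by auto
  qed (auto simp: nth_lift_entries[OF il])
  have disjs: "lift_entries i D T ! r \<inter> lift_entries i D T ! s = {}"
    if "r < length mu" "s < length mu" "r \<noteq> s" for r s
    using disj[OF that] that by (auto simp: mem split: if_splits)
  have "(\<Union>r<length mu. lift_entries i D T ! r) = (\<Union>r<length mu. T ! r)"
  proof (rule Set.set_eqI)
    fix x
    have "x \<in> D \<Longrightarrow> x \<in> T ! (Suc i)" using D(1) by blast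
    then have "(\<exists>r<length mu. x \<in> lift_entries i D T ! r) \<longleftrightarrow> (\<exists>r<length mu. x \<in> T ! r)"
      using i by (cases "x \<in> D") (auto simp: mem intro: exI[of _ i] exI[of _ "Suc i"])
    then show "x \<in> (\<Union>r<length mu. lift_entries i D T ! r) \<longleftrightarrow> x \<in> (\<Union>r<length mu. T ! r)" by blast
  qed
  then have unions: "\<Union>(set (lift_entries i D T)) = {1..sum_list mu}"
    using un by (simp add: Union_set_nth len)
  show "lift_entries i D T \<in> tabloids (raised_shape i d mu)"
    unfolding tabloids_iff set_partition_def using cards disjs unions d i
    by (simp add: sum_list_raised_shape len)
qed

lemma lower_entries_tabloids:
  assumes i: "Suc i < length mu" and d: "d \<le> mu ! Suc i"
    and V: "V \<in> tabloids (raised_shape i d mu)" and D: "D \<subseteq> V ! i" "card D = d"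
  shows "lower_entries i D V \<in> tabloids mu"
proof -
  have sp: "set_partition (raised_shape i d mu) V" using V by (simp add: tabloids_iff)
  have len: "length V = length mu" and card: "\<And>r. r < length mu \<Longrightarrow> card (V ! r) = raised_shape i d mu ! r"
    and disj: "\<And>r s. r < length mu \<Longrightarrow> s < length mu \<Longrightarrow> r \<noteq> s \<Longrightarrow> V ! r \<inter> V ! s = {}"
    and un: "\<Union>(set V) = {1..sum_list mu}"
    using sp d i unfolding set_partition_def by (auto simp: sum_list_raised_shape)
  have fin: "finite (V ! r)" if "r < length mu" for r
    using set_partition_finite[OF sp] that by simp
  have finD: "finite D" using D(1) fin i by (meson Suc_lessD finite_subset)
  have il: "Suc i < length V" using i len by simp
  have dj: "V ! Suc i \<inter> D = {}" using D(1) disj[of i "Suc i"] i by auto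
  have cards: "card (lower_entries i D V ! r) = mu ! r" if "r < length mu" for r
    using that D(2) finD dj i card[OF that] fin d
    by (auto simp: nth_lower_entries[OF il] nth_raised_shape[OF i] card_Un_disjoint card_Diff_subset D(1))
  have mem: "x \<in> lower_entries i D V ! r \<longleftrightarrow> (if x \<in> D then r = Suc i else x \<in> V ! r)"
    if "r < length mu" for x r
  proof (cases "x \<in> D")
    case True
    then have "x \<in> V ! (i)" using D(1) by blast
    then have "x \<in> V ! r \<Longrightarrow> r = i" using disj[OF that, of "i"] i by fastforce
    then show ?thesis using True unfolding nth_lower_entries[OF il] by auto
  qed (auto simp: nth_lower_entries[OF il])
  have disjs: "lower_entries i D V ! r \<inter> lower_entries i D V ! s = {}"
    if "r < length mu" "s < length mu" "r \<noteq> s" for r s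
    using disj[OF that] that by (auto simp: mem split: if_splits)
  have "(\<Union>r<length mu. lower_entries i D V ! r) = (\<Union>r<length mu. V ! r)"
  proof (rule Set.set_eqI)
    fix x
    have "x \<in> D \<Longrightarrow> x \<in> V ! (i)" using D(1) by blast
    then have "(\<exists>r<length mu. x \<in> lower_entries i D V ! r) \<longleftrightarrow> (\<exists>r<length mu. x \<in> V ! r)"
      using i by (cases "x \<in> D") (auto simp: mem intro: exI[of _ i] exI[of _ "Suc i"])
    then show "x \<in> (\<Union>r<length mu. lower_entries i D V ! r) \<longleftrightarrow> x \<in> (\<Union>r<length mu. V ! r)" by blast
  qed
  then have unions: "\<Union>(set (lower_entries i D V)) = {1..sum_list mu}"
    using un by (simp add: Union_set_nth len)
  show ?thesis
    unfolding tabloids_iff set_partition_def using cards disjs unions by (simp add: len)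
qed

lemma raise_diff: "raise i d (u - v) V = raise i d u V - raise i d v V"
  by (simp add: raise_def sum_subtractf)

lemma raise_add: "raise i d (u + v) V = raise i d u V + raise i d v V"
  by (simp add: raise_def sum.distrib)

lemma raise_scale: "raise i d (scale c u) V = c * raise i d u V"
  by (simp add: raise_def scale_def sum_distrib_left)

lemma lower_entries_map:
  assumes "inj g" "Suc i < length V"
  shows "lower_entries i (g ` D) (map ((`) g) V) = map ((`) g) (lower_entries i D V)"
  using assms by (intro nth_equalityI) (auto simp: nth_lower_entries image_set_diff image_Un)

lemma lift_entries_map:
  assumes "inj g" "Suc i < length V"
  shows "lift_entries i (g ` D) (map ((`) g) V) = map ((`) g) (lift_entries i D V)"
  using assms by (intro nth_equalityI) (auto simp: nth_lift_entries image_set_diff image_Un)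

lemma raise_perm_act:
  assumes "bij g" "Suc i < length V"
  shows "raise i d (perm_act g u) V = perm_act g (raise i d u) V"
proof -
  let ?g = "inv_into UNIV g"
  have inj: "inj ?g" and inv: "\<And>A. ?g ` g ` A = A" "\<And>A. g ` ?g ` A = A"
    using assms(1) by (simp_all add: bij_imp_bij_inv bij_is_inj bij_is_surj image_image surj_f_inv_f)
  have il: "Suc i < length (map ((`) ?g) V)" using assms(2) by simp
  have row: "map ((`) ?g) V ! i = ?g ` (V ! i)" using assms(2) by simp
  have "raise i d (perm_act g u) V
      = (\<Sum>D | D \<subseteq> V ! i \<and> card D = d. u (lower_entries i (?g ` D) (map ((`) ?g) V)))"
    unfolding raise_def perm_act_def lower_entries_map[OF inj assms(2)] ..
  also have "\<dots> = (\<Sum>D | D \<subseteq> ?g ` (V ! i) \<and> card D = d. u (lower_entries i D (map ((`) ?g) V)))"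
  proof (rule sum.reindex_bij_witness[where j = "\<lambda>D. ?g ` D" and i = "\<lambda>D. g ` D"])
    have card: "card (h ` D) = card D" if "inj h" for h and D :: "nat set"
      using that by (intro card_image) (rule inj_on_subset, auto)
    fix D assume D: "D \<in> {D. D \<subseteq> ?g ` (V ! i) \<and> card D = d}"
    then have "g ` D \<subseteq> g ` ?g ` (V ! i)" by blast
    then show "g ` D \<in> {D. D \<subseteq> V ! i \<and> card D = d}"
      using D unfolding inv by (simp add: card bij_is_inj[OF assms(1)])
    show "?g ` g ` D = D" by (rule inv)
  next
    have card: "card (h ` D) = card D" if "inj h" for h and D :: "nat set"
      using that by (intro card_image) (rule inj_on_subset, auto)
    fix D assume D: "D \<in> {D. D \<subseteq> V ! i \<and> card D = d}"
    then show "?g ` D \<in> {D. D \<subseteq> ?g ` (V ! i) \<and> card D = d}"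
      by (auto simp: card inj)
    show "g ` ?g ` D = D" by (rule inv)
  qed (rule refl)
  also have "\<dots> = perm_act g (raise i d u) V"
    unfolding perm_act_def raise_def row ..
  finally show ?thesis .
qed

text \<open>
  Each tabloid of the raised shape arises from one tabloid for each choice of the lifted entries
  among those now in row $i$, whence the binomial coefficient.
\<close>

lemma raise_constant:
  assumes i: "Suc i < length mu" and d: "d \<le> mu ! Suc i"
    and V: "V \<in> tabloids (raised_shape i d mu)"
    and u: "\<And>T. T \<in> tabloids mu \<Longrightarrow> u T = a"
  shows "raise i d u V = of_nat ((mu ! i + d) choose d) * a"
proof -
  have sp: "set_partition (raised_shape i d mu) V" using V by (simp add: tabloids_iff)
  have card: "card (V ! i) = mu ! i + d" and fin: "finite (V ! i)"
    using sp set_partition_finite[OF sp, of i] i by (auto simp: set_partition_def nth_raised_shape)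
  have "raise i d u V = (\<Sum>D | D \<subseteq> V ! i \<and> card D = d. a)"
    unfolding raise_def by (intro sum.cong refl u lower_entries_tabloids[OF i d V]) auto
  then show ?thesis using n_subsets[OF fin, of d] card by simp
qed

text \<open>
  The two operators touch disjoint pairs of rows.
\<close>

lemma raise_commute:
  assumes "Suc l < length V" "Suc m < length V" "Suc l < m \<or> Suc m < l"
  shows "raise l c (raise m d u) V = raise m d (raise l c u) V"
proof -
  have nth: "lower_entries l D V ! m = V ! m" "lower_entries m D V ! l = V ! l" for D
    using assms by (auto simp: nth_lower_entries)
  have swap: "lower_entries m E (lower_entries l D V) = lower_entries l D (lower_entries m E V)" for D E
    using assms by (intro nth_equalityI) (auto simp: nth_lower_entries)
  show ?thesis
    unfolding raise_def nth swap by (rule sum.swap)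
qed

section \<open>Polytabloids are highest weight vectors\<close>

text \<open>
  The condition quantifies over all $V$ with disjoint rows $i$ and $i+1$, of whatever shape. For
  elements of a permutation module this only adds equations \<open>0 = 0\<close>
  (\<open>highest_weightI\<close>), and it frees the use of the condition from any bookkeeping
  of shapes.
\<close>

definition highest_weight :: "nat list \<Rightarrow> (nat set list \<Rightarrow> 'k::field) \<Rightarrow> bool" where
  "highest_weight lam u \<longleftrightarrow> (\<forall>i d V. Suc i < length lam \<and> length V = length lam \<and>
     finite (V ! i) \<and> V ! i \<inter> V ! Suc i = {} \<and> 0 < d \<longrightarrow> raise i d u V = 0)"

lemma highest_weightD:
  "highest_weight lam u \<Longrightarrow> Suc i < length lam \<Longrightarrow> length V = length lam \<Longrightarrow>
     finite (V ! i) \<Longrightarrow> V ! i \<inter> V ! Suc i = {} \<Longrightarrow> 0 < d \<Longrightarrow> raise i d u V = 0"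
  unfolding highest_weight_def by blast

lemma highest_weightI:
  assumes u: "u \<in> perm_module lam"
    and r: "\<And>i d V. Suc i < length lam \<Longrightarrow> 0 < d \<Longrightarrow> d \<le> lam ! Suc i \<Longrightarrow>
       V \<in> tabloids (raised_shape i d lam) \<Longrightarrow> raise i d u V = 0"
  shows "highest_weight lam u"
  unfolding highest_weight_def
proof (intro allI impI, elim conjE)
  fix i d :: nat and V :: "nat set list"
  assume i: "Suc i < length lam" and len: "length V = length lam"
    and disj: "V ! i \<inter> V ! Suc i = {}" and d: "0 < d"
  show "raise i d u V = 0"
  proof (rule ccontr)
    assume ne: "raise i d u V \<noteq> 0"
    then obtain D where D: "D \<subseteq> V ! i" "card D = d" and uD: "u (lower_entries i D V) \<noteq> 0"
      unfolding raise_def by (metis (mono_tags, lifting) mem_Collect_eq sum.neutral)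
    have T: "lower_entries i D V \<in> tabloids lam" using u uD by (simp add: perm_module_iff)
    have "D \<subseteq> lower_entries i D V ! Suc i" using i len by (simp add: nth_lower_entries)
    note lift = lift_entries_tabloids[OF i T this D(2)]
    have "V \<in> tabloids (raised_shape i d lam)"
      using lift(1) i len D(1) disj by (simp add: lift_lower_entries)
    then show False using r[OF i d lift(2)] ne by blast
  qed
qed

lemma highest_weight_diff:
  "highest_weight lam u \<Longrightarrow> highest_weight lam v \<Longrightarrow> highest_weight lam (u - v)"
  unfolding highest_weight_def raise_diff by simp

lemma raise_zero: "raise i d 0 V = 0"
  by (simp add: raise_def)

lemma highest_weight_subspace: "module.subspace scale {u. highest_weight lam u}"
proof -
  interpret vector_space "scale :: 'a \<Rightarrow> _" by (rule vector_space_scale)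
  show ?thesis
    by (rule subspaceI) (auto simp: highest_weight_def raise_zero raise_add raise_scale)
qed

lemma finite_column_stabilizer: "finite (column_stabilizer lam t)"
  by (rule finite_subset[OF _ finite_permutations[of "{1..sum_list lam}"]])
     (auto simp: column_stabilizer_def)

lemma polytabloid_apply:
  "(polytabloid lam t :: _ \<Rightarrow> 'k::field) V = of_int
     (\<Sum>\<pi>\<in>column_stabilizer lam t. if tabloid_of lam (\<pi> \<circ> t) = V then sign \<pi> else 0)"
  unfolding polytabloid_def sum_fun_apply of_int_sum
  by (intro sum.cong) (auto simp: scale_def basis_vec_def)

lemma column_stabilizer_comp:
  assumes "\<pi> \<in> column_stabilizer lam t" "\<rho> \<in> column_stabilizer lam t"
  shows "\<pi> \<circ> \<rho> \<in> column_stabilizer lam t"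
  using assms unfolding column_stabilizer_def mem_Collect_eq
  by (simp only: permutes_compose image_comp[symmetric] simp_thms)

lemma transpose_in_column_stabilizer:
  assumes t: "tableau lam t" and d: "(r, c) \<in> diagram lam" "(s, c) \<in> diagram lam"
  shows "transpose (t (r, c)) (t (s, c)) \<in> column_stabilizer lam t"
proof -
  have inj: "inj_on t (diagram lam)" and im: "t ` diagram lam = {1..sum_list lam}"
    using t unfolding tableau_def bij_betw_def by auto
  have "transpose (t (r, c)) (t (s, c)) permutes {1..sum_list lam}"
    using d unfolding im[symmetric] by (intro permutes_swap_id) auto
  moreover have "transpose (t (r, c)) (t (s, c)) ` {t (r, c') |r. (r, c') \<in> diagram lam}
      = {t (r, c') |r. (r, c') \<in> diagram lam}" for c'
    by (rule transpose_image_eq) (use d in \<open>auto dest: inj_onD[OF inj]\<close>)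
  ultimately show ?thesis unfolding column_stabilizer_def by blast
qed

text \<open>
  If the transposition of $x$ and $y$ fixes $L$, then $\pi$ and $\pi \circ (x\,y)$ send $L$ to
  the same place with opposite signs. The sum is taken over the integers, where $S = -S$ forces
  $S = 0$; over a field this would fail in characteristic 2.
\<close>

lemma signed_column_sum_zero:
  fixes L V :: "nat set list"
  assumes tau: "transpose x y \<in> column_stabilizer lam t" and xy: "x \<noteq> y"
    and L: "\<And>r. r < length L \<Longrightarrow> x \<in> L ! r \<longleftrightarrow> y \<in> L ! r"
  shows "(\<Sum>\<pi>\<in>column_stabilizer lam t. if map ((`) \<pi>) L = V then sign \<pi> else (0 :: int)) = 0"
    (is "?S = 0")
proof -
  let ?\<tau> = "transpose x y"
  have fix_L: "map ((`) ?\<tau>) L = L"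
    by (rule nth_equalityI) (auto simp: L transpose_image_eq)
  have fixL: "map ((`) (\<pi> \<circ> ?\<tau>)) L = map ((`) \<pi>) L" for \<pi>
    using arg_cong[OF fix_L, of "map ((`) \<pi>)"] by (simp add: image_comp)
  have sgn: "sign (\<pi> \<circ> ?\<tau>) = - sign \<pi>" if "\<pi> \<in> column_stabilizer lam t" for \<pi>
  proof -
    have "permutation \<pi>" using that unfolding column_stabilizer_def
      by (metis (mono_tags, lifting) finite_atLeastAtMost mem_Collect_eq permutation_permutes)
    then show ?thesis by (simp add: sign_compose permutation_swap_id sign_swap_id xy)
  qed
  have "?S = (\<Sum>\<pi>\<in>column_stabilizer lam t. - (if map ((`) \<pi>) L = V then sign \<pi> else 0))"
    by (rule sum.reindex_bij_witness[where i = "\<lambda>\<pi>. \<pi> \<circ> ?\<tau>" and j = "\<lambda>\<pi>. \<pi> \<circ> ?\<tau>"])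
       (auto simp: column_stabilizer_comp[OF _ tau] sgn fixL comp_assoc simp del: map_map)
  then have "?S = - ?S" by (simp add: sum_negf)
  then show ?thesis by simp
qed

text \<open>
  Lifting a nonempty set $E$ of entries from row $i+1$ commutes with the column stabilizer, so
  the result is a signed column sum of the tabloid $\{t\}$ with $E$ lifted. There an entry $y
  \in E$ has joined the entry $x$ just above it, and the transposition of $x$ and $y$ fixes this
  tabloid.
\<close>

lemma raise_polytabloid:
  fixes V :: "nat set list"
  assumes t: "tableau lam t" and i: "Suc i < length lam" and le: "lam ! Suc i \<le> lam ! i"
    and len: "length V = length lam" and fin: "finite (V ! i)"
    and disj: "V ! i \<inter> V ! Suc i = {}" and d: "0 < d"
  shows "raise i d (polytabloid lam t) V = 0"
proof -
  let ?C = "column_stabilizer lam t" and ?T = "tabloid_of lam t"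
  have inj: "inj_on t (diagram lam)" using t unfolding tableau_def bij_betw_def by auto
  have T: "?T \<in> tabloids lam" using t by (auto simp: tabloids_def)
  have sp: "set_partition lam ?T" using T by (simp add: tabloids_iff)
  have finT: "finite (?T ! Suc i)" using set_partition_finite[OF sp i] .
  have il: "Suc i < length V" "Suc i < length ?T" using i len by simp_all
  \<comment> \<open>The sets $D$ that may be lowered from $V$ to reach $\pi\{t\}$ are the images $\pi E$.\<close>
  have reindex: "(\<Sum>D | D \<subseteq> V ! i \<and> card D = d. if tabloid_of lam (\<pi> \<circ> t) = lower_entries i D V then sign \<pi> else 0)
      = (\<Sum>E | E \<subseteq> ?T ! Suc i \<and> card E = d. if map ((`) \<pi>) (lift_entries i E ?T) = V then sign \<pi> else 0)"
    (is "?l = ?r") if p: "\<pi> \<in> ?C" for \<pi>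
  proof -
    have bij: "bij \<pi>" using p by (auto simp: column_stabilizer_def permutes_bij)
    let ?q = "inv_into UNIV \<pi>"
    have qinj: "inj ?q" and inv: "\<And>A. ?q ` \<pi> ` A = A" "\<And>A. \<pi> ` ?q ` A = A"
      using bij by (simp_all add: bij_imp_bij_inv bij_is_inj bij_is_surj image_image surj_f_inv_f)
    have pinj: "inj \<pi>" using bij by (rule bij_is_inj)
    have card: "card (h ` D) = card D" if "inj h" for h and D :: "nat set"
      using that by (intro card_image) (rule inj_on_subset, auto)
    let ?P = "map ((`) \<pi>) ?T"
    have P: "tabloid_of lam (\<pi> \<circ> t) = ?P" by (simp add: map_image_tabloid_of)
    have Pl: "Suc i < length ?P" using i by simp
    have Pd: "?P ! i \<inter> ?P ! Suc i = {}"
    proof -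
      have "?T ! i \<inter> ?T ! Suc i = {}" using sp i unfolding set_partition_def
        by (metis Suc_lessD n_not_Suc_n)
      then show ?thesis using i by (simp add: image_Int[OF pinj, symmetric])
    qed
    have "?l = (\<Sum>D | D \<in> {D. D \<subseteq> V ! i \<and> card D = d} \<and> ?P = lower_entries i D V. sign \<pi>)"
      unfolding P using fin by (intro sum.inter_filter[symmetric]) auto
    also have "\<dots> = (\<Sum>E | E \<in> {E. E \<subseteq> ?T ! Suc i \<and> card E = d} \<and> map ((`) \<pi>) (lift_entries i E ?T) = V. sign \<pi>)"
    proof (rule sum.reindex_bij_witness[where j = "\<lambda>D. ?q ` D" and i = "\<lambda>D. \<pi> ` D"])
      fix D assume "D \<in> {D \<in> {D. D \<subseteq> V ! i \<and> card D = d}. ?P = lower_entries i D V}"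
      then have D: "D \<subseteq> V ! i" "card D = d" "?P = lower_entries i D V" by auto
      have "?P ! Suc i = V ! Suc i \<union> D" unfolding D(3) using il(1) by (simp add: nth_lower_entries)
      then have "D \<subseteq> \<pi> ` (?T ! Suc i)" using i by auto
      then have "?q ` D \<subseteq> ?T ! Suc i" using inv(1) by (metis image_mono)
      moreover have "map ((`) \<pi>) (lift_entries i (?q ` D) ?T) = V"
        unfolding lift_entries_map[OF pinj il(2), symmetric] inv D(3)
        by (rule lift_lower_entries[OF il(1) D(1) disj])
      ultimately show "?q ` D \<in> {E \<in> {E. E \<subseteq> ?T ! Suc i \<and> card E = d}. map ((`) \<pi>) (lift_entries i E ?T) = V}"
        using D(2) by (simp add: card qinj)
      show "\<pi> ` ?q ` D = D" by (rule inv)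
    next
      fix E assume "E \<in> {E \<in> {E. E \<subseteq> ?T ! Suc i \<and> card E = d}. map ((`) \<pi>) (lift_entries i E ?T) = V}"
      then have E: "E \<subseteq> ?T ! Suc i" "card E = d" "V = lift_entries i (\<pi> ` E) ?P"
        unfolding lift_entries_map[OF pinj il(2)] by auto
      have "\<pi> ` E \<subseteq> ?P ! Suc i" using E(1) i by auto
      then have "?P = lower_entries i (\<pi> ` E) V"
        unfolding E(3) using Pl Pd by (simp add: lower_lift_entries)
      moreover have "\<pi> ` E \<subseteq> V ! i" unfolding E(3) nth_lift_entries[OF Pl] by simp
      ultimately show "\<pi> ` E \<in> {D \<in> {D. D \<subseteq> V ! i \<and> card D = d}. ?P = lower_entries i D V}"
        using E(2) by (simp add: card pinj)
      show "?q ` \<pi> ` E = E" by (rule inv)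
    qed (rule refl)
    also have "\<dots> = ?r"
      using finT by (intro sum.inter_filter) auto
    finally show ?thesis .
  qed
  have zero: "(\<Sum>\<pi>\<in>?C. if map ((`) \<pi>) (lift_entries i E ?T) = V then sign \<pi> else (0 :: int)) = 0"
    if E: "E \<subseteq> ?T ! Suc i" "card E = d" for E
  proof -
    obtain y where y: "y \<in> E" using E(2) d by fastforce
    then obtain c where c: "c < lam ! Suc i" "y = t (Suc i, c)" using E(1) i by (auto simp: tabloid_of_nth)
    have dg: "(i, c) \<in> diagram lam" "(Suc i, c) \<in> diagram lam"
      using c i le by (auto simp: diagram_def)
    have x: "t (i, c) \<in> ?T ! i" using dg(1) by (auto simp: diagram_def tabloid_of_nth)
    have yT: "y \<in> ?T ! Suc i" using y E(1) by blast
    have neq: "t (i, c) \<noteq> y" unfolding c(2) using dg inj by (auto dest: inj_onD)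
    have other: "z \<notin> ?T ! s" if "z \<in> ?T ! r" "r < length lam" "s < length lam" "r \<noteq> s" for z r s
      using sp that unfolding set_partition_def by blast
    have "transpose (t (i, c)) y \<in> ?C"
      unfolding c(2) using t dg by (rule transpose_in_column_stabilizer)
    moreover have "t (i, c) \<in> lift_entries i E ?T ! r \<longleftrightarrow> y \<in> lift_entries i E ?T ! r"
      if "r < length (lift_entries i E ?T)" for r
      using that y x other[OF x, of r] other[OF yT, of r] i unfolding nth_lift_entries[OF il(2)] by auto
    ultimately show ?thesis using neq by (intro signed_column_sum_zero)
  qed
  have "raise i d (polytabloid lam t) V = of_int (\<Sum>D | D \<subseteq> V ! i \<and> card D = d. \<Sum>\<pi>\<in>?C.
      if tabloid_of lam (\<pi> \<circ> t) = lower_entries i D V then sign \<pi> else 0)"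
    unfolding raise_def polytabloid_apply of_int_sum ..
  also have "\<dots> = of_int (\<Sum>\<pi>\<in>?C. \<Sum>E | E \<subseteq> ?T ! Suc i \<and> card E = d.
      if map ((`) \<pi>) (lift_entries i E ?T) = V then sign \<pi> else 0)"
    by (subst sum.swap) (simp only: reindex cong: sum.cong)
  also have "\<dots> = of_int (\<Sum>E | E \<subseteq> ?T ! Suc i \<and> card E = d. \<Sum>\<pi>\<in>?C.
      if map ((`) \<pi>) (lift_entries i E ?T) = V then sign \<pi> else 0)"
    by (subst sum.swap) (rule refl)
  also have "\<dots> = 0" using zero by simp
  finally show ?thesis .
qed

lemma partition_antimono:
  assumes "partition_of lam n" "r \<le> s" "s < length lam"
  shows "lam ! s \<le> lam ! r"
  using assms by (cases "r = s") (auto simp: partition_of_def sorted_wrt_iff_nth_less)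

lemma specht_highest_weight:
  fixes u :: "nat set list \<Rightarrow> 'k::field"
  assumes lam: "partition_of lam n" and u: "u \<in> specht lam"
  shows "highest_weight lam u"
proof -
  interpret vector_space "scale :: 'k \<Rightarrow> _" by (rule vector_space_scale)
  have "polytabloid lam t \<in> {u. highest_weight lam u}" if "tableau lam t" for t
    using that partition_antimono[OF lam]
    by (auto simp: highest_weight_def intro!: raise_polytabloid)
  then have "specht lam \<subseteq> {u :: _ \<Rightarrow> 'k. highest_weight lam u}"
    unfolding specht_def by (intro span_minimal highest_weight_subspace) auto
  then show ?thesis using u by blast
qed

section \<open>The kernel of the raising operators is the Specht module\<close>

lemma subsets_insert_card:
  assumes "finite W" "p \<notin> W" "0 < c"
  shows "{D. D \<subseteq> insert p W \<and> card D = c} =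
     {D. D \<subseteq> W \<and> card D = c} \<union> insert p ` {D. D \<subseteq> W \<and> card D = c - 1}"
proof (intro equalityI subsetI)
  fix D assume "D \<in> {D. D \<subseteq> insert p W \<and> card D = c}"
  then have D: "D \<subseteq> insert p W" "card D = c" by auto
  show "D \<in> {D. D \<subseteq> W \<and> card D = c} \<union> insert p ` {D. D \<subseteq> W \<and> card D = c - 1}"
  proof (cases "p \<in> D")
    case True
    then have "D = insert p (D - {p})" "D - {p} \<subseteq> W" "card (D - {p}) = c - 1"
      using D by (auto simp: card_Diff_singleton)
    then show ?thesis by blast
  qed (use D in auto)
next
  fix D assume "D \<in> {D. D \<subseteq> W \<and> card D = c} \<union> insert p ` {D. D \<subseteq> W \<and> card D = c - 1}"
  then show "D \<in> {D. D \<subseteq> insert p W \<and> card D = c}"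
  proof
    assume "D \<in> insert p ` {D. D \<subseteq> W \<and> card D = c - 1}"
    then obtain E where E: "D = insert p E" "E \<subseteq> W" "card E = c - 1" by auto
    then have "finite E" "p \<notin> E" using assms by (auto intro: finite_subset)
    then show ?thesis using E assms(3) by auto
  qed auto
qed

text \<open>
  The dual form of the Garnir relations. The equations of a highest weight element only concern
  sums over all ways to lower $c$ entries of a whole row. Here the entries of $P$ are forced to
  stay in row $i$; induction on $P$ removes this constraint one entry $p$ at a time: the sum
  with $p$ held in row $i$ is the sum with $p$ free minus the sum with $p$ held in row $i+1$.
  The last one lowers only $c - 1$ further entries, and the hypothesis that $P$ has fewer than
  $c$ elements guarantees that the unconstrained sums reached at the end still lower at least
  one entry.
\<close>

lemma garnir_sum_zero:
  fixes u :: "nat set list \<Rightarrow> 'k::field"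
  assumes u: "highest_weight lam u" and i: "Suc i < length lam" and T: "length T = length lam"
    and "finite P" "finite W" "card P < c" "P \<inter> W = {}" "P \<inter> R = {}" "W \<inter> R = {}"
  shows "(\<Sum>D | D \<subseteq> W \<and> card D = c. u (T[i := P \<union> (W - D), Suc i := R \<union> D])) = 0"
  using assms(4-)
proof (induction P arbitrary: W c R rule: finite_induct)
  case empty
  let ?V = "T[i := W, Suc i := R]"
  have V: "?V ! i = W" "?V ! Suc i = R" using i T by (simp_all add: nth_list_update)
  have "raise i c u ?V = 0"
    by (rule highest_weightD[OF u i]) (use T V empty in auto)
  moreover have "lower_entries i D ?V = T[i := {} \<union> (W - D), Suc i := R \<union> D]" for D
    unfolding lower_entries_def V by (simp add: list_update_swap[of "Suc i" i])
  ultimately show ?case unfolding raise_def V by simp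
next
  case (insert p P)
  let ?f = "\<lambda>D. u (T[i := P \<union> (insert p W - D), Suc i := R \<union> D])"
  have pW: "p \<notin> W" and c: "0 < c" using insert.prems by auto
  have card: "card P < c - 1" using insert.prems(2) insert.hyps by simp
  have "(\<Sum>D | D \<subseteq> insert p W \<and> card D = c. ?f D) = 0"
    by (rule insert.IH) (use insert.prems insert.hyps in auto)
  moreover have "(\<Sum>D | D \<subseteq> insert p W \<and> card D = c. ?f D)
      = (\<Sum>D | D \<subseteq> W \<and> card D = c. ?f D) + (\<Sum>D \<in> insert p ` {D. D \<subseteq> W \<and> card D = c - 1}. ?f D)"
    unfolding subsets_insert_card[OF insert.prems(1) pW c]
    by (rule sum.union_disjoint) (use insert.prems(1) pW in auto)
  moreover have "(\<Sum>D | D \<subseteq> W \<and> card D = c. ?f D)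
      = (\<Sum>D | D \<subseteq> W \<and> card D = c. u (T[i := insert p P \<union> (W - D), Suc i := R \<union> D]))"
  proof (rule sum.cong[OF refl])
    fix D assume "D \<in> {D. D \<subseteq> W \<and> card D = c}"
    then have "P \<union> (insert p W - D) = insert p P \<union> (W - D)" using pW by auto
    then show "?f D = u (T[i := insert p P \<union> (W - D), Suc i := R \<union> D])" by simp
  qed
  moreover have "(\<Sum>D \<in> insert p ` {D. D \<subseteq> W \<and> card D = c - 1}. ?f D)
      = (\<Sum>D | D \<subseteq> W \<and> card D = c - 1. u (T[i := P \<union> (W - D), Suc i := insert p R \<union> D]))"
  proof (subst sum.reindex)
    show "inj_on (insert p) {D. D \<subseteq> W \<and> card D = c - 1}"
      using pW by (auto intro!: inj_onI)
    show "sum (?f \<circ> insert p) {D. D \<subseteq> W \<and> card D = c - 1} =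
      (\<Sum>D | D \<subseteq> W \<and> card D = c - 1. u (T[i := P \<union> (W - D), Suc i := insert p R \<union> D]))"
    proof (rule sum.cong[OF refl])
      fix D assume "D \<in> {D. D \<subseteq> W \<and> card D = c - 1}"
      have "insert p W - insert p D = W - D" "R \<union> insert p D = insert p R \<union> D" using pW by auto
      then show "(?f \<circ> insert p) D = u (T[i := P \<union> (W - D), Suc i := insert p R \<union> D])" by simp
    qed
  qed
  moreover have "\<dots> = 0"
    by (rule insert.IH) (use insert.prems insert.hyps pW card in auto)
  ultimately show ?case by simp
qed

definition row_of :: "nat set list \<Rightarrow> nat \<Rightarrow> nat" where
  "row_of T x = (THE r. r < length T \<and> x \<in> T ! r)"

text \<open>
  The tabloid is read as a number in base \<open>length lam + 1\<close> whose digit at place $x$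
  is the row of $x$. Comparing weights thus compares the rows of the largest entry on which two
  tabloids differ, and a tabloid is large if its large entries lie in low rows. Among the
  tabloids that occur in a polytabloid of a tableau with increasing columns, that of the tableau
  itself is the largest.
\<close>

definition weight :: "nat list \<Rightarrow> nat set list \<Rightarrow> nat" where
  "weight lam T = (\<Sum>x\<in>{1..sum_list lam}. row_of T x * Suc (length lam) ^ x)"

lemma row_of_eq:
  assumes T: "T \<in> tabloids lam" and r: "r < length lam" "x \<in> T ! r"
  shows "row_of T x = r"
proof -
  have len: "length T = length lam" using T by (auto simp: tabloids_iff set_partition_def)
  show ?thesis unfolding row_of_def
  proof (rule the_equality)
    show "s = r" if "s < length T \<and> x \<in> T ! s" for s
      using that r T len unfolding tabloids_iff set_partition_def by (metis disjoint_iff)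
  qed (use r len in simp)
qed

lemma exists_row:
  assumes "T \<in> tabloids lam" "x \<in> {1..sum_list lam}"
  obtains r where "r < length lam" "x \<in> T ! r"
proof -
  have "length T = length lam" "\<Union>(set T) = {1..sum_list lam}"
    using assms(1) unfolding tabloids_iff set_partition_def by blast+
  then have "x \<in> (\<Union>r<length lam. T ! r)" using assms(2) Union_set_nth[of T] by metis
  then show ?thesis using that by blast
qed

lemma sum_digits_lt: "(\<Sum>x<m. k * Suc k ^ x) < Suc k ^ m"
proof -
  have "(\<Sum>x<m. k * Suc k ^ x) + 1 = Suc k ^ m" by (induction m) auto
  then show ?thesis by linarith
qed

lemma weight_less:
  assumes T: "T \<in> tabloids lam" and m: "m \<in> {1..sum_list lam}" "row_of T m < row_of T' m"
    and eq: "\<And>x. x \<in> {1..sum_list lam} \<Longrightarrow> m < x \<Longrightarrow> row_of T x = row_of T' x"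
  shows "weight lam T < weight lam T'"
proof -
  let ?B = "Suc (length lam)"
  have split: "weight lam U = (\<Sum>x\<in>{1..<m}. row_of U x * ?B ^ x) + (row_of U m * ?B ^ m +
      (\<Sum>x\<in>{m<..sum_list lam}. row_of U x * ?B ^ x))" for U
  proof -
    have "{1..sum_list lam} = {1..<m} \<union> insert m {m<..sum_list lam}" using m(1) by auto
    then have "weight lam U = (\<Sum>x\<in>{1..<m}. row_of U x * ?B ^ x) +
        (\<Sum>x\<in>insert m {m<..sum_list lam}. row_of U x * ?B ^ x)"
      unfolding weight_def by (simp only:) (rule sum.union_disjoint, auto)
    then show ?thesis by simp
  qed
  have "(\<Sum>x\<in>{1..<m}. row_of T x * ?B ^ x) \<le> (\<Sum>x\<in>{1..<m}. length lam * ?B ^ x)"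
  proof (rule sum_mono)
    fix x assume x: "x \<in> {1..<m}"
    then have "x \<in> {1..sum_list lam}" using m(1) by simp
    then obtain r where "r < length lam" "x \<in> T ! r" using exists_row[OF T] by blast
    then show "row_of T x * ?B ^ x \<le> length lam * ?B ^ x"
      using row_of_eq[OF T] by simp
  qed
  also have "\<dots> \<le> (\<Sum>x<m. length lam * ?B ^ x)" by (rule sum_mono2) auto
  also have "\<dots> < ?B ^ m" by (rule sum_digits_lt)
  finally have low: "(\<Sum>x\<in>{1..<m}. row_of T x * ?B ^ x) < ?B ^ m" .
  have "Suc (row_of T m) * ?B ^ m \<le> row_of T' m * ?B ^ m" using m(2) by (intro mult_right_mono) auto
  then have mid: "row_of T m * ?B ^ m + ?B ^ m \<le> row_of T' m * ?B ^ m" by simp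
  have "(\<Sum>x\<in>{m<..sum_list lam}. row_of T x * ?B ^ x) = (\<Sum>x\<in>{m<..sum_list lam}. row_of T' x * ?B ^ x)"
    using eq m(1) by (intro sum.cong) auto
  with low mid show ?thesis unfolding split[of T] split[of T'] by linarith
qed

definition increasing_columns :: "nat list \<Rightarrow> (nat \<times> nat \<Rightarrow> nat) \<Rightarrow> bool" where
  "increasing_columns lam t \<longleftrightarrow>
     (\<forall>r c. (Suc r, c) \<in> diagram lam \<longrightarrow> t (r, c) < t (Suc r, c))"

lemma increasing_columns_less:
  assumes lam: "partition_of lam n" and t: "increasing_columns lam t"
    and "r < s" "(s, c) \<in> diagram lam"
  shows "t (r, c) < t (s, c)"
  using assms(3,4)
proof (induction s)
  case (Suc s)
  have sc: "(s, c) \<in> diagram lam"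
    using Suc.prems(2) partition_antimono[OF lam, of s "Suc s"] by (auto simp: diagram_def)
  have step: "t (s, c) < t (Suc s, c)" using t Suc.prems(2) by (simp add: increasing_columns_def)
  show ?case
  proof (cases "r = s")
    case False
    then have "r < s" using Suc.prems(1) by simp
    then have "t (r, c) < t (s, c)" using Suc.IH sc by blast
    then show ?thesis using step by simp
  qed (use step in simp)
qed simp

text \<open>
  Let $m$ be the largest entry moved by $\pi$. Its place in $\pi t$ is the place in $t$ of a
  smaller entry of the same column, hence a higher one, and all entries above $m$ stay where
  they are.
\<close>

lemma weight_column_permutation:
  assumes lam: "partition_of lam n" and t: "tableau lam t" and inc: "increasing_columns lam t"
    and p: "\<pi> \<in> column_stabilizer lam t" and ne: "\<pi> \<noteq> id"
  shows "weight lam (tabloid_of lam (\<pi> \<circ> t)) < weight lam (tabloid_of lam t)"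
proof -
  have perm: "\<pi> permutes {1..sum_list lam}" using p by (simp add: column_stabilizer_def)
  have im: "t ` diagram lam = {1..sum_list lam}" using t unfolding tableau_def bij_betw_def by auto
  have pt: "tableau lam (\<pi> \<circ> t)" using perm t by (rule tableau_comp)
  have row: "row_of (tabloid_of lam s) (s (r, c)) = r" if "tableau lam s" "(r, c) \<in> diagram lam" for s r c
    using that by (intro row_of_eq[of _ lam]) (auto simp: tabloids_def diagram_def tabloid_of_nth)
  let ?M = "{x. \<pi> x \<noteq> x}"
  have sub: "?M \<subseteq> {1..sum_list lam}" using perm by (auto simp: permutes_def)
  then have finM: "finite ?M" by (rule finite_subset) simp
  have "?M \<noteq> {}" using ne by (auto simp: fun_eq_iff)
  define m where "m = Max ?M"
  have mM: "m \<in> ?M" and above: "\<And>x. m < x \<Longrightarrow> \<pi> x = x"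
    unfolding m_def using Max_in[OF finM \<open>?M \<noteq> {}\<close>] Max_ge[OF finM] by (auto simp: not_less[symmetric])
  then have "m \<in> t ` diagram lam" using sub im by blast
  then obtain s c where sc: "(s, c) \<in> diagram lam" "m = t (s, c)" by auto
  let ?col = "{t (r, c) |r. (r, c) \<in> diagram lam}"
  have "\<pi> ` ?col = ?col" using p by (simp add: column_stabilizer_def)
  then have "m \<in> \<pi> ` ?col" using sc by auto
  then obtain r where r: "(r, c) \<in> diagram lam" "m = \<pi> (t (r, c))" by auto
  have "t (r, c) \<noteq> m" using mM r(2) by auto
  then have "\<pi> (t (r, c)) \<noteq> t (r, c)" using r(2) by simp
  then have "t (r, c) < m" using above \<open>t (r, c) \<noteq> m\<close> by (meson linorder_neqE_nat)
  then have rs: "r < s"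
    using increasing_columns_less[OF lam inc, of s r c] r(1) sc
    by (cases r s rule: linorder_cases) auto
  have "row_of (tabloid_of lam (\<pi> \<circ> t)) m = r" using row[OF pt r(1)] r(2) by simp
  moreover have "row_of (tabloid_of lam t) m = s" using row[OF t sc(1)] sc(2) by simp
  moreover have "row_of (tabloid_of lam (\<pi> \<circ> t)) x = row_of (tabloid_of lam t) x"
    if "x \<in> {1..sum_list lam}" "m < x" for x
  proof -
    have "x \<in> t ` diagram lam" using that(1) im by blast
    then obtain a b where ab: "(a, b) \<in> diagram lam" "x = t (a, b)" by auto
    have "(\<pi> \<circ> t) (a, b) = x" using above that(2) ab(2) by simp
    then show ?thesis using row[OF pt ab(1)] row[OF t ab(1)] ab(2) by simp
  qed
  ultimately show ?thesis
    using rs mM sub pt by (intro weight_less[where m = m]) (auto simp: tabloids_def)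
qed

lemma id_in_column_stabilizer: "id \<in> column_stabilizer lam t"
  by (simp add: column_stabilizer_def permutes_id)

lemma polytabloid_leading:
  assumes lam: "partition_of lam n" and t: "tableau lam t" and inc: "increasing_columns lam t"
  shows "(polytabloid lam t :: _ \<Rightarrow> 'k::field) (tabloid_of lam t) = 1"
    and "(polytabloid lam t :: _ \<Rightarrow> 'k) V \<noteq> 0 \<Longrightarrow> V \<noteq> tabloid_of lam t \<Longrightarrow>
      weight lam V < weight lam (tabloid_of lam t)"
proof -
  let ?C = "column_stabilizer lam t"
  have less: "weight lam (tabloid_of lam (\<pi> \<circ> t)) < weight lam (tabloid_of lam t)"
    if "\<pi> \<in> ?C" "\<pi> \<noteq> id" for \<pi>
    using weight_column_permutation[OF lam t inc that] .
  have "(\<Sum>\<pi>\<in>?C. if tabloid_of lam (\<pi> \<circ> t) = tabloid_of lam t then sign \<pi> else 0)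
      = (\<Sum>\<pi>\<in>?C. if \<pi> = id then 1 else 0)"
  proof (rule sum.cong[OF refl])
    fix \<pi> assume "\<pi> \<in> ?C"
    then show "(if tabloid_of lam (\<pi> \<circ> t) = tabloid_of lam t then sign \<pi> else 0) = (if \<pi> = id then 1 else 0)"
      using less[of \<pi>] by (cases "\<pi> = id") (auto simp: sign_id)
  qed
  also have "\<dots> = 1"
    using id_in_column_stabilizer[of lam t] by (simp only: sum.delta[OF finite_column_stabilizer]) simp
  finally show "(polytabloid lam t :: _ \<Rightarrow> 'k) (tabloid_of lam t) = 1"
    unfolding polytabloid_apply by (simp only: of_int_1)
  assume nz: "(polytabloid lam t :: _ \<Rightarrow> 'k) V \<noteq> 0" and ne: "V \<noteq> tabloid_of lam t"
  have "\<exists>\<pi>\<in>?C. tabloid_of lam (\<pi> \<circ> t) = V"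
  proof (rule ccontr)
    assume "\<not> ?thesis"
    then have "(\<Sum>\<pi>\<in>?C. if tabloid_of lam (\<pi> \<circ> t) = V then sign \<pi> else 0) = 0"
      by (intro sum.neutral) auto
    then show False using nz unfolding polytabloid_apply by (simp only: of_int_0 simp_thms)
  qed
  then obtain \<pi> where p: "\<pi> \<in> ?C" "tabloid_of lam (\<pi> \<circ> t) = V" by blast
  then have "\<pi> \<noteq> id" using ne by auto
  then show "weight lam V < weight lam (tabloid_of lam t)" using less p by blast
qed

text \<open>
  Suppose that a column decreases between rows $i$ and $i+1$, with $x > y$ there. Let $X$ be $x$
  and all that follows it in its row, and $Y$ be $y$ and all that precedes it. Every element of
  $X$ exceeds every element of $Y$, and the Garnir relation for $X \cup Y$, with the entries
  before $x$ held in row $i$, involves $T$ and otherwise only tabloids in which some element of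
  $X$ has moved down in exchange for an element of $Y$. These have larger weight, so $u$
  vanishes on them, and hence on $T$.
\<close>

lemma leading_tabloid_increasing_columns:
  fixes u :: "nat set list \<Rightarrow> 'k::field"
  assumes lam: "partition_of lam n" and u: "highest_weight lam u" and supp: "u \<in> perm_module lam"
    and nz: "u T \<noteq> 0" and max: "\<And>T'. u T' \<noteq> 0 \<Longrightarrow> weight lam T' \<le> weight lam T"
  shows "increasing_columns lam (row_tableau T)"
  unfolding increasing_columns_def
proof (intro allI impI, rule ccontr)
  fix i c assume dg: "(Suc i, c) \<in> diagram lam"
    and viol: "\<not> row_tableau T (i, c) < row_tableau T (Suc i, c)"
  have T: "T \<in> tabloids lam" using supp nz by (simp add: perm_module_iff)
  then have sp: "set_partition lam T" by (simp add: tabloids_iff)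
  have i: "Suc i < length lam" and c: "c < lam ! Suc i" using dg by (auto simp: diagram_def)
  then have c': "c < lam ! i" using partition_antimono[OF lam, of i "Suc i"] by simp
  define xs where "xs = sorted_list_of_set (T ! i)"
  define ys where "ys = sorted_list_of_set (T ! Suc i)"
  have len: "length T = length lam" and fin: "finite (T ! i)" "finite (T ! Suc i)"
    using sp i set_partition_finite[OF sp] by (auto simp: set_partition_def)
  have xs: "set xs = T ! i" "sorted_wrt (<) xs" "distinct xs" "length xs = lam ! i"
    and ys: "set ys = T ! Suc i" "sorted_wrt (<) ys" "distinct ys" "length ys = lam ! Suc i"
    using fin sp i by (auto simp: xs_def ys_def set_partition_def)
  have disj: "T ! i \<inter> T ! Suc i = {}" using sp i unfolding set_partition_def
    by (metis Suc_lessD n_not_Suc_n)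
  have "ys ! c \<le> xs ! c" using viol by (simp add: row_tableau_def xs_def ys_def)
  define P X where "P = set (take c xs)" and "X = set (drop c xs)"
  define Y R where "Y = set (take (Suc c) ys)" and "R = set (drop (Suc c) ys)"
  have PX: "P \<union> X = T ! i" "P \<inter> X = {}" "card P = c"
    unfolding P_def X_def using xs c' set_append[of "take c xs" "drop c xs"]
    by (auto simp: distinct_card distinct_take set_take_disj_set_drop_if_distinct)
  have YR: "Y \<union> R = T ! Suc i" "Y \<inter> R = {}" "card Y = Suc c"
    unfolding Y_def R_def using ys c set_append[of "take (Suc c) ys" "drop (Suc c) ys"]
    by (auto simp: distinct_card distinct_take set_take_disj_set_drop_if_distinct)
  have finPX: "finite P" "finite X" "finite Y" by (simp_all add: P_def X_def Y_def)
  have sep: "y < x" if xX: "x \<in> X" and yY: "y \<in> Y" for x y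
  proof -
    obtain a where a: "c \<le> a" "a < length xs" "x = xs ! a"
    proof -
      obtain k where "k < length (drop c xs)" "x = drop c xs ! k"
        using xX unfolding X_def in_set_conv_nth by auto
      then show ?thesis using \<open>c < lam ! i\<close> xs(4) by (intro that[of "c + k"]) auto
    qed
    obtain b where b: "b \<le> c" "b < length ys" "y = ys ! b"
    proof -
      obtain k where "k < length (take (Suc c) ys)" "y = take (Suc c) ys ! k"
        using yY unfolding Y_def in_set_conv_nth by auto
      then show ?thesis by (intro that[of k]) auto
    qed
    have "xs ! c \<le> xs ! a" using a xs(2) by (metis le_eq_less_or_eq sorted_wrt_nth_less)
    moreover have "ys ! b \<le> ys ! c" using b ys(2,4) c by (metis le_eq_less_or_eq sorted_wrt_nth_less)
    ultimately have "y \<le> x" using \<open>ys ! c \<le> xs ! c\<close> a b by linarith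
    moreover have "y \<noteq> x" using xX yY PX YR disj by blast
    ultimately show ?thesis by simp
  qed
  let ?W = "X \<union> Y"
  let ?U = "\<lambda>D. T[i := P \<union> (?W - D), Suc i := R \<union> D]"
  have XY: "X \<inter> Y = {}" using PX YR disj by blast
  have "(\<Sum>D | D \<subseteq> ?W \<and> card D = Suc c. u (?U D)) = 0"
    by (rule garnir_sum_zero[OF u i len]) (use PX YR disj finPX in auto)
  moreover have "u (?U D) = 0" if D: "D \<subseteq> ?W" "card D = Suc c" "D \<noteq> Y" for D
  proof (rule ccontr)
    assume nzD: "u (?U D) \<noteq> 0"
    then have U: "?U D \<in> tabloids lam" using supp by (simp add: perm_module_iff)
    have nth: "?U D ! r = (if r = i then P \<union> (?W - D) else if r = Suc i then R \<union> D else T ! r)" for r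
      using i len by (auto simp: nth_list_update)
    have finD: "finite D" using D(2) by (metis card.infinite nat.distinct(1))
    have "\<not> D \<subseteq> Y" using D(2,3) YR(3) finPX(3) by (metis card_subset_eq)
    then have ne: "D - Y \<noteq> {}" by blast
    define m where "m = Max (D - Y)"
    have m: "m \<in> D - Y" and above: "x \<le> m" if "x \<in> D - Y" for x
      unfolding m_def using Max_in[OF _ ne] Max_ge finD that by auto
    have mX: "m \<in> X" using m ne D(1) by blast
    have mT: "m \<in> T ! i" using mX PX by blast
    have rows: "row_of T m = i" "row_of (?U D) m = Suc i"
      using row_of_eq[OF T _ mT] row_of_eq[OF U, of "Suc i" m] i m ne nth[of "Suc i"] by auto
    have "weight lam T < weight lam (?U D)"
    proof (rule weight_less[OF T])
      show "m \<in> {1..sum_list lam}"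
        using mT i len sp unfolding set_partition_def Union_set_nth by fastforce
      show "row_of T m < row_of (?U D) m" by (simp only: rows lessI)
      fix x assume x: "x \<in> {1..sum_list lam}" "m < x"
      then obtain r where r: "r < length lam" "x \<in> T ! r" using exists_row[OF T] by blast
      have "x \<notin> Y" using sep[OF mX] x(2) by force
      moreover have "x \<notin> D" using above[of x] x(2) \<open>x \<notin> Y\<close> by force
      ultimately have "x \<in> ?U D ! r" using r(2) PX(1) YR(1) unfolding nth by auto
      then show "row_of T x = row_of (?U D) x"
        using row_of_eq[OF T r] row_of_eq[OF U r(1)] by simp
    qed
    then show False using max[OF nzD] by simp
  qed
  ultimately have "u (?U Y) = 0"
  proof -
    assume s: "(\<Sum>D | D \<subseteq> ?W \<and> card D = Suc c. u (?U D)) = 0"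
      and z: "\<And>D. D \<subseteq> ?W \<Longrightarrow> card D = Suc c \<Longrightarrow> D \<noteq> Y \<Longrightarrow> u (?U D) = 0"
    have "(\<Sum>D | D \<subseteq> ?W \<and> card D = Suc c. u (?U D)) = u (?U Y) +
        (\<Sum>D \<in> {D. D \<subseteq> ?W \<and> card D = Suc c} - {Y}. u (?U D))"
      using YR(3) finPX by (intro sum.remove) auto
    also have "(\<Sum>D \<in> {D. D \<subseteq> ?W \<and> card D = Suc c} - {Y}. u (?U D)) = 0"
      using z by (intro sum.neutral) auto
    finally show ?thesis using s by simp
  qed
  moreover have "?U Y = T"
  proof -
    have "?W - Y = X" "R \<union> Y = T ! Suc i" using XY YR by auto
    then show ?thesis using PX(1) by (simp only: list_update_id)
  qed
  ultimately show False using nz by simp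
qed

text \<open>
  The difficult half of James' kernel intersection theorem: the Specht module contains every
  element of the permutation module killed by all raising operators. All tabloids of maximal
  weight in such an element have increasing columns, so subtracting the corresponding
  polytabloids yields another such element of smaller leading weight.
\<close>

theorem highest_weight_in_specht:
  fixes u :: "nat set list \<Rightarrow> 'k::field"
  assumes lam: "partition_of lam n" and u: "highest_weight lam u" "u \<in> perm_module lam"
  shows "u \<in> specht lam"
proof -
  interpret vector_space "scale :: 'k \<Rightarrow> _" by (rule vector_space_scale)
  have "u \<in> specht lam" if "\<And>T. u T \<noteq> 0 \<Longrightarrow> weight lam T < N" for N
    using u that
  proof (induction N arbitrary: u)
    case 0
    then have "u = 0" by (auto simp: fun_eq_iff)
    then show ?case unfolding specht_def by (simp only: span_zero)
  next
    case (Suc N)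
    let ?e = "\<lambda>T. polytabloid lam (row_tableau T) :: nat set list \<Rightarrow> 'k"
    let ?L = "{T. u T \<noteq> 0 \<and> weight lam T = N}"
    define v where "v = (\<Sum>T\<in>?L. scale (u T) (?e T))"
    have L: "T \<in> tabloids lam" if "T \<in> ?L" for T
      using that Suc.prems(2) by (auto simp: perm_module_iff)
    then have finL: "finite ?L" using finite_tabloids[of lam] by (meson finite_subset subsetI)
    have tab: "tableau lam (row_tableau T)" "tabloid_of lam (row_tableau T) = T" if "T \<in> ?L" for T
      using L[OF that] row_tableau unfolding tabloids_iff by blast+
    have inc: "increasing_columns lam (row_tableau T)" if "T \<in> ?L" for T
      using that Suc.prems by (intro leading_tabloid_increasing_columns[OF lam]) (auto simp: less_Suc_eq_le)
    have eT: "?e T T = 1" if "T \<in> ?L" for T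
      using polytabloid_leading(1)[OF lam tab(1) inc, OF that that] tab(2)[OF that] by simp
    have eV: "weight lam V < N" if "T \<in> ?L" "?e T V \<noteq> 0" "V \<noteq> T" for T V
      using polytabloid_leading(2)[OF lam tab(1) inc, OF that(1,1,2)] tab(2)[OF that(1)] that(1,3) by simp
    have vS: "v \<in> specht lam"
      unfolding v_def specht_def by (intro span_sum span_scale span_base) (use tab(1) in blast)
    have vV: "v V = u V" if "N \<le> weight lam V" for V
    proof -
      have "v V = (\<Sum>T\<in>?L. u T * ?e T V)" by (simp add: v_def sum_fun_apply scale_def)
      also have "\<dots> = (\<Sum>T\<in>?L. if T = V then u V else 0)"
        using eT eV that by (intro sum.cong refl) fastforce
      also have "\<dots> = (if V \<in> ?L then u V else 0)" using finL by (simp add: sum.delta')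
      also have "\<dots> = u V" using Suc.prems(3)[of V] that by (cases "u V = 0") auto
      finally show ?thesis .
    qed
    have "u - v \<in> specht lam"
    proof (rule Suc.IH)
      show "highest_weight lam (u - v)"
        by (rule highest_weight_diff[OF Suc.prems(1) specht_highest_weight[OF lam vS]])
      have "v \<in> perm_module lam" using vS specht_subset_perm_module by blast
      then show "u - v \<in> perm_module lam"
        using Suc.prems(2) unfolding perm_module_def by (intro span_diff)
      show "weight lam T < N" if "(u - v) T \<noteq> 0" for T
        using that vV[of T] by (cases "N \<le> weight lam T") auto
    qed
    then have "(u - v) + v \<in> specht lam" using vS unfolding specht_def by (rule span_add)
    then show ?case by simp
  qed
  moreover have "weight lam T < Suc (Max (weight lam ` tabloids lam))" if "u T \<noteq> 0" for T
    using u(2) that finite_tabloids[of lam] by (auto simp: perm_module_iff less_Suc_eq_le)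
  ultimately show ?thesis by blast
qed

section \<open>First cohomology of permutation modules\<close>

lemma perm_act_apply:
  assumes "g permutes S"
  shows "perm_act g w (map ((`) g) T) = w T"
  using assms by (simp add: perm_act_def o_def image_image permutes_inverses)

text \<open>
  On the stabilizer of $T$ the map $h \mapsto f(h)(T)$ is a homomorphism into the additive group
  of the field, in which 2 is invertible. The stabilizer is generated by transpositions within
  the rows of $T$, and elements of order 2 map to 0. Generation by transpositions takes the form
  of an induction on the number of moved points: composing $h$ with the transposition of $a$ and
  $h(a)$ makes $a$ a fixed point.
\<close>

lemma cocycle_vanishes_on_stabilizer:
  fixes f :: "(nat \<Rightarrow> nat) \<Rightarrow> nat set list \<Rightarrow> 'k::field"
  assumes two: "(2 :: 'k) \<noteq> 0" and fin: "finite S"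
    and cocycle: "\<And>g h. g permutes S \<Longrightarrow> h permutes S \<Longrightarrow> f (g \<circ> h) = f g + perm_act g (f h)"
    and h: "h permutes S" "map ((`) h) T = T"
  shows "f h T = 0"
  using h
proof (induction "card {x. h x \<noteq> x}" arbitrary: h rule: less_induct)
  case less
  have f_comp: "f (g \<circ> h) T = f g T + f h T"
    if "g permutes S" "h permutes S" "map ((`) g) T = T" for g h
    using cocycle[OF that(1,2)] perm_act_apply[OF that(1), of "f h" T] that(3) by simp
  have f_id: "f id T = 0"
  proof -
    have "f id T = f id T + f id T" using f_comp[of id id] by (simp only: permutes_id comp_id list.map_id0 image_id id_apply)
    then show ?thesis by (metis add_cancel_right_right)
  qed
  show ?case
  proof (cases "h = id")
    case False
    then obtain a where a: "h a \<noteq> a" by (auto simp: fun_eq_iff)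
    define b where "b = h a"
    define h' where "h' = transpose a b \<circ> h"
    have inj: "inj h" using less.prems(1) by (rule permutes_inj)
    have S: "a \<in> S" "b \<in> S"
      using a less.prems(1) by (auto simp: b_def permutes_def permutes_in_image[OF less.prems(1)])
    have tau: "transpose a b permutes S" using S by (rule permutes_swap_id)
    then have h': "h' permutes S" unfolding h'_def using less.prems(1) by (intro permutes_compose)
    have rows: "h ` (T ! r) = T ! r" if "r < length T" for r
      using that arg_cong[OF less.prems(2), of "\<lambda>L. L ! r"] by simp
    have tauT: "map ((`) (transpose a b)) T = T"
    proof (rule nth_equalityI)
      fix r assume "r < length (map ((`) (transpose a b)) T)"
      then have r: "r < length T" by simp
      have "a \<in> T ! r \<longleftrightarrow> b \<in> T ! r"
        unfolding b_def using rows[OF r] inj by (metis inj_image_mem_iff)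
      then show "map ((`) (transpose a b)) T ! r = T ! r" using r by (simp add: transpose_image_eq)
    qed simp
    have h'T: "map ((`) h') T = T"
    proof -
      have "map ((`) h') T = map ((`) (transpose a b)) (map ((`) h) T)"
        by (simp add: h'_def image_comp)
      then show ?thesis using less.prems(2) tauT by simp
    qed
    have "{x. h' x \<noteq> x} \<subset> {x. h x \<noteq> x}"
    proof
      show "{x. h' x \<noteq> x} \<subseteq> {x. h x \<noteq> x}"
      proof (intro subsetI CollectI notI)
        fix x assume x: "x \<in> {x. h' x \<noteq> x}" and hx: "h x = x"
        have "x \<noteq> a" using a hx by blast
        moreover from this have "x \<noteq> b" using injD[OF inj, of x a] hx by (auto simp: b_def)
        ultimately have "h' x = x" using hx by (simp add: h'_def)
        then show False using x by simp
      qed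
      have "h' a = a" by (simp add: h'_def b_def)
      then show "{x. h' x \<noteq> x} \<noteq> {x. h x \<noteq> x}" using a by blast
    qed
    moreover have "finite {x. h x \<noteq> x}"
      using less.prems(1) by (intro finite_subset[OF _ fin]) (auto simp: permutes_def)
    ultimately have "f h' T = 0" by (intro less.hyps h' h'T psubset_card_mono)
    moreover have "f (transpose a b) T = 0"
    proof -
      have "transpose a b \<circ> transpose a b = id" by simp
      then have "f (transpose a b) T + f (transpose a b) T = 0"
        using f_comp[OF tau tau tauT] f_id by simp
      then have "2 * f (transpose a b) T = 0" by simp
      then show ?thesis using two by simp
    qed
    moreover have "h = transpose a b \<circ> h'" by (simp add: h'_def fun_eq_iff)
    ultimately show ?thesis using f_comp[OF tau h' tauT] by simp
  qed (simp add: f_id)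
qed

lemma map_image_inv:
  assumes "g permutes S"
  shows "map ((`) g) (map ((`) (inv_into UNIV g)) T) = T"
    and "map ((`) (inv_into UNIV g)) (map ((`) g) T) = T"
  using assms by (simp_all add: o_def image_image permutes_inverses)

text \<open>
  The vanishing of $H^1(\mathcal{S}_n, M^\lambda)$ in characteristic other than 2, which is
  Shapiro's lemma made explicit. A cochain $u$ with $u(T_0) = 0$ must satisfy $u(gT_0) =
  -f(g)(gT_0)$; this is a valid definition because $f$ vanishes on the stabilizer of $T_0$.
\<close>

lemma perm_module_cocycle_is_coboundary:
  fixes f :: "(nat \<Rightarrow> nat) \<Rightarrow> nat set list \<Rightarrow> 'k::field" and lam :: "nat list"
  defines "S \<equiv> {1..sum_list lam}"
  assumes two: "(2 :: 'k) \<noteq> 0"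
    and cocycle: "\<And>g h. g permutes S \<Longrightarrow> h permutes S \<Longrightarrow> f (g \<circ> h) = f g + perm_act g (f h)"
    and f: "\<And>g. g permutes S \<Longrightarrow> f g \<in> perm_module lam"
  obtains u where "u \<in> perm_module lam" "\<And>g. g permutes S \<Longrightarrow> f g = perm_act g u - u"
proof -
  obtain T0 where T0: "T0 \<in> tabloids lam" using tabloids_nonempty by blast
  have "\<exists>g. g permutes S \<and> map ((`) g) T0 = T" if "T \<in> tabloids lam" for T
    using tabloids_transitive[OF T0 that] unfolding S_def by blast
  then obtain x where x: "x T permutes S" "map ((`) (x T)) T0 = T" if "T \<in> tabloids lam" for T
    by metis
  \<comment> \<open>The permutation \<open>x T\<close> is an arbitrary choice among those that carry $T_0$ to $T$.\<close>
  define u where "u = (\<lambda>T. if T \<in> tabloids lam then - f (x T) T else 0)"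
  have f_comp: "f (g \<circ> h) (map ((`) g) T) = f g (map ((`) g) T) + f h T"
    if "g permutes S" "h permutes S" for g h T
    using cocycle[OF that] perm_act_apply[OF that(1)] by simp
  have u_eq: "u (map ((`) g) T0) = - f g (map ((`) g) T0)" if g: "g permutes S" for g
  proof -
    let ?T = "map ((`) g) T0"
    have T: "?T \<in> tabloids lam" using map_image_tabloids T0 g by (simp add: S_def)
    define h where "h = inv_into UNIV (x ?T) \<circ> g"
    have h: "h permutes S" unfolding h_def using g x(1)[OF T] by (intro permutes_compose permutes_inv)
    have xh: "x ?T \<circ> h = g" using x(1)[OF T] by (simp add: h_def fun_eq_iff permutes_inverses)
    have "map ((`) h) T0 = map ((`) (inv_into UNIV (x ?T))) ?T"
      by (simp add: h_def image_comp)
    also have "\<dots> = map ((`) (inv_into UNIV (x ?T))) (map ((`) (x ?T)) T0)"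
      using x(2)[OF T] by simp
    also have "\<dots> = T0" using x(1)[OF T] by (rule map_image_inv)
    finally have "f h T0 = 0"
      using cocycle_vanishes_on_stabilizer[OF two _ cocycle h] by (simp add: S_def)
    then have "f g ?T = f (x ?T) ?T"
      using f_comp[OF x(1)[OF T] h, of T0] unfolding xh x(2)[OF T] by simp
    then show ?thesis using T by (simp add: u_def)
  qed
  show ?thesis
  proof
    show "u \<in> perm_module lam" by (simp add: perm_module_iff u_def)
    fix g assume g: "g permutes S"
    show "f g = perm_act g u - u"
    proof
      fix T
      let ?U = "map ((`) (inv_into UNIV g)) T"
      have gU: "map ((`) g) ?U = T" using g by (rule map_image_inv)
      have act: "perm_act g u T = u ?U" by (simp add: perm_act_def)
      show "f g T = (perm_act g u - u) T"
      proof (cases "T \<in> tabloids lam")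
        case True
        have U: "?U \<in> tabloids lam" using True g permutes_inv[OF g] map_image_tabloids unfolding S_def by blast
        have "g \<circ> x ?U permutes S" using g x(1)[OF U] by (intro permutes_compose)
        moreover have gx: "map ((`) (g \<circ> x ?U)) T0 = T"
        proof -
          have "map ((`) (g \<circ> x ?U)) T0 = map ((`) g) (map ((`) (x ?U)) T0)"
            by (simp add: image_comp)
          then show ?thesis unfolding x(2)[OF U] gU .
        qed
        ultimately have "u T = - f (g \<circ> x ?U) T" using u_eq[of "g \<circ> x ?U"] by (simp only: gx)
        also have "\<dots> = - f g T - f (x ?U) ?U"
          using f_comp[OF g x(1)[OF U], of ?U] unfolding gU by simp
        also have "\<dots> = - f g T + u ?U" using U by (simp add: u_def)
        finally show ?thesis by (simp add: act)
      next
        case False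
        then have "f g T = 0" using f[OF g] by (auto simp: perm_module_iff)
        moreover have "?U \<notin> tabloids lam"
          using False gU map_image_tabloids g unfolding S_def by metis
        ultimately have "u T = 0" "u ?U = 0" using False by (simp_all add: u_def)
        then show ?thesis using \<open>f g T = 0\<close> by (simp add: act)
      qed
    qed
  qed
qed

section \<open>Pairs that are not James\<close>

text \<open>
  Since $p^v$ divides $a + 1$, the numbers $a + 1 + j$ and $j$ are divisible by the same powers
  of $p$ as long as $0 < j < p^v$.
\<close>

lemma multiplicity_fact_shift:
  fixes p a v j :: nat
  assumes p: "prime p" and v: "multiplicity p (a + 1) = v" and j: "j < p ^ v"
  shows "multiplicity p (fact (a + 1 + j) :: nat) = multiplicity p (fact a :: nat) + v + multiplicity p (fact j :: nat)"
  using j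
proof (induction j)
  case 0
  have "fact (a + 1) = (a + 1) * (fact a :: nat)" by simp
  then have "multiplicity p (fact (a + 1) :: nat) = multiplicity p (a + 1) + multiplicity p (fact a :: nat)"
    using p by (simp only:) (rule prime_elem_multiplicity_mult_distrib, auto)
  then show ?case using v by simp
next
  case (Suc j)
  have "multiplicity p (Suc j + (a + 1)) = multiplicity p (Suc j)"
  proof (rule multiplicity_sum_lt)
    have "\<not> p ^ v dvd Suc j" using Suc.prems by (auto dest: dvd_imp_le)
    then show "multiplicity p (Suc j) < multiplicity p (a + 1)"
      unfolding v using multiplicity_dvd' by (metis not_le)
  qed auto
  moreover have "fact (a + 1 + Suc j) = (Suc j + (a + 1)) * (fact (a + 1 + j) :: nat)"
    by (simp add: algebra_simps)
  moreover have "multiplicity p ((Suc j + (a + 1)) * fact (a + 1 + j)) =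
      multiplicity p (Suc j + (a + 1)) + multiplicity p (fact (a + 1 + j) :: nat)"
    using p by (intro prime_elem_multiplicity_mult_distrib) auto
  ultimately have shifted: "multiplicity p (fact (a + 1 + Suc j) :: nat) =
      multiplicity p (Suc j) + multiplicity p (fact (a + 1 + j) :: nat)"
    by (simp only:)
  have "multiplicity p (Suc j * fact j) = multiplicity p (Suc j) + multiplicity p (fact j :: nat)"
    using p by (intro prime_elem_multiplicity_mult_distrib) auto
  then have "multiplicity p (fact (Suc j) :: nat) = multiplicity p (Suc j) + multiplicity p (fact j :: nat)"
    by (simp only: fact_Suc of_nat_id)
  moreover have "j < p ^ v" using Suc.prems by simp
  ultimately show ?case using Suc.IH shifted by linarith
qed

lemma exists_nonzero_digit:
  assumes "prime p" "0 < (x::nat)"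
  shows "digit p x (multiplicity p x) \<noteq> 0"
proof -
  have "\<not> p dvd x div p ^ multiplicity p x"
    using assms by (intro multiplicity_decompose) auto
  then show ?thesis by (simp add: digit_def dvd_eq_mod_eq_0)
qed

lemma val_eq_multiplicity:
  assumes p: "prime p" and x: "0 < (x::nat)"
  shows "val p x = multiplicity p x"
  unfolding val_def
proof (rule Least_equality)
  show "digit p x (multiplicity p x) \<noteq> 0" using p x by (rule exists_nonzero_digit)
  fix i assume i: "digit p x i \<noteq> 0"
  show "multiplicity p x \<le> i"
  proof (rule ccontr)
    assume "\<not> multiplicity p x \<le> i"
    then have "p ^ Suc i dvd x" by (intro multiplicity_dvd') simp
    then obtain m where "x = p ^ i * (p * m)" 
    proof -
      obtain m where "x = p ^ Suc i * m" using \<open>p ^ Suc i dvd x\<close> by (rule dvdE)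
      then show ?thesis by (intro that[of m]) simp
    qed
    then have "x div p ^ i = p * m" using p by (simp add: prime_gt_0_nat)
    then show False using i by (simp add: digit_def)
  qed
qed

lemma power_len_le:
  assumes p: "prime p" and x: "0 < (x::nat)"
  shows "p ^ len p x \<le> x"
proof -
  have le: "p ^ i \<le> x" if "digit p x i \<noteq> 0" for i
    using that by (metis digit_def div_less mod_0 not_le)
  have "digit p x (len p x) \<noteq> 0"
    unfolding len_def
  proof (rule GreatestI_nat[where P = "\<lambda>i. digit p x i \<noteq> 0", OF exists_nonzero_digit[OF p x]])
    fix i assume "digit p x i \<noteq> 0"
    then have "p ^ i \<le> x" by (rule le)
    moreover have "i < p ^ i" using prime_ge_2_nat[OF p] by (intro power_gt_expt) simp
    ultimately show "i \<le> x" by simp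
  qed
  then show ?thesis by (rule le)
qed

text \<open>
  With $v = \mathrm{val}_p(a+1)$ one may take $d = p^v$. The product of $a+1, \dots, a+d$ and
  the product of $1, \dots, d$ have the same multiplicity of $p$: the factor $a + 1$ contributes
  $v$ as does $d$, and $a + 1 + j$ contributes as much as $j$. That the pair is not James means
  precisely that this $d$ is at most $b$.
\<close>

lemma not_James_binomial:
  assumes p: "prime p" and b: "0 < b" and nJ: "\<not> James p a b"
  obtains d where "0 < d" "d \<le> b" "\<not> p dvd ((a + d) choose d)"
proof
  let ?v = "multiplicity p (a + 1)"
  let ?q = "p ^ ?v"
  have q0: "0 < ?q" using p by (simp add: prime_gt_0_nat)
  then show "0 < ?q" .
  have "?v \<le> len p b" using nJ val_eq_multiplicity[OF p, of "a + 1"] by (simp add: James_def)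
  then have "?q \<le> p ^ len p b" using prime_ge_1_nat[OF p] by (intro power_increasing) simp_all
  also have "\<dots> \<le> b" using p b by (rule power_len_le)
  finally show "?q \<le> b" .
  show "\<not> p dvd ((a + ?q) choose ?q)"
  proof -
    have pe: "prime_elem p" using p by simp
    have "fact ?q * fact a * ((a + ?q) choose ?q) = (fact (a + ?q) :: nat)"
      using binomial_fact_lemma[of ?q "a + ?q"] by simp
    moreover have "multiplicity p (fact ?q * fact a * ((a + ?q) choose ?q)) =
        multiplicity p (fact ?q * fact a :: nat) + multiplicity p ((a + ?q) choose ?q)"
      using pe by (intro prime_elem_multiplicity_mult_distrib) auto
    moreover have "multiplicity p (fact ?q * fact a :: nat) =
        multiplicity p (fact ?q :: nat) + multiplicity p (fact a :: nat)"
      using pe by (intro prime_elem_multiplicity_mult_distrib) auto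
    ultimately have "multiplicity p (fact (a + ?q) :: nat) =
        multiplicity p (fact ?q :: nat) + multiplicity p (fact a :: nat) + multiplicity p ((a + ?q) choose ?q)"
      by simp
    moreover have "multiplicity p (fact (a + ?q) :: nat) =
        multiplicity p (fact a :: nat) + ?v + multiplicity p (fact (?q - 1) :: nat)"
    proof -
      have "a + 1 + (?q - 1) = a + ?q" "?q - 1 < ?q" using q0 by simp_all
      then show ?thesis using multiplicity_fact_shift[OF p refl, of "?q - 1" a] by (simp only:)
    qed
    moreover have "multiplicity p (fact ?q :: nat) = ?v + multiplicity p (fact (?q - 1) :: nat)"
    proof -
      have "(fact ?q :: nat) = ?q * fact (?q - 1)" using q0 by (simp add: fact_reduce)
      moreover have "multiplicity p ?q = ?v" using p by (simp add: prime_elem_multiplicity_power_distrib)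
      ultimately show ?thesis using pe q0 by (simp add: prime_elem_multiplicity_mult_distrib)
    qed
    ultimately have "multiplicity p ((a + ?q) choose ?q) = 0" by linarith
    moreover have "((a + ?q) choose ?q) \<noteq> 0" by simp
    ultimately show ?thesis using prime_elem_multiplicity_eq_zero_iff[OF pe] by blast
  qed
qed

section \<open>Vanishing of the first cohomology\<close>

text \<open>
  Up to scalars this is the only element of $M^\lambda$ fixed by $\mathcal{S}_n$.
\<close>

definition tabloid_sum :: "nat list \<Rightarrow> nat set list \<Rightarrow> 'k::field" where
  "tabloid_sum lam = (\<lambda>T. if T \<in> tabloids lam then 1 else 0)"

lemma perm_act_tabloid_sum:
  assumes g: "g permutes {1..sum_list lam}"
  shows "perm_act g (tabloid_sum lam) = tabloid_sum lam"
proof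
  fix T
  have "map ((`) (inv_into UNIV g)) T \<in> tabloids lam \<longleftrightarrow> T \<in> tabloids lam"
    using map_image_tabloids[OF g] map_image_tabloids[OF permutes_inv[OF g]] map_image_inv(1)[OF g]
    by metis
  then show "perm_act g (tabloid_sum lam) T = tabloid_sum lam T"
    by (simp add: perm_act_def tabloid_sum_def)
qed

text \<open>
  The raising operators commute with the group and kill $gu - u$, so the image of $u$ is
  invariant; the group is transitive on tabloids.
\<close>

lemma raise_constant_on_tabloids:
  fixes u :: "nat set list \<Rightarrow> 'k::field"
  assumes hw: "\<And>g. g permutes {1..sum_list lam} \<Longrightarrow> highest_weight lam (perm_act g u - u)"
    and l: "Suc l < length lam" and d: "0 < d" "d \<le> lam ! Suc l"
  obtains a where "\<And>V. V \<in> tabloids (raised_shape l d lam) \<Longrightarrow> raise l d u V = a"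
proof -
  let ?mu = "raised_shape l d lam"
  have eq: "raise l d u V = raise l d u V'" if VV: "V \<in> tabloids ?mu" "V' \<in> tabloids ?mu" for V V'
  proof -
    obtain g where g: "g permutes {1..sum_list lam}" "map ((`) g) V = V'"
      using tabloids_transitive[OF VV] sum_list_raised_shape[OF l d(2)] by metis
    have sp: "set_partition ?mu V'" using VV(2) by (simp add: tabloids_iff)
    then have len: "length V' = length lam" and disj: "V' ! l \<inter> V' ! Suc l = {}"
      using l unfolding set_partition_def by auto
    have fin: "finite (V' ! l)" using set_partition_finite[OF sp] l by simp
    have "raise l d (perm_act g u - u) V' = 0"
      using highest_weightD[OF hw[OF g(1)] l len fin disj d(1)] .
    then have "raise l d u V' = perm_act g (raise l d u) V'"
      using raise_perm_act[of g l V' d u] permutes_bij[OF g(1)] l len by (simp add: raise_diff)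
    also have "\<dots> = raise l d u V" using perm_act_apply[OF g(1)] g(2) by metis
    finally show ?thesis ..
  qed
  obtain V0 where "V0 \<in> tabloids ?mu" using tabloids_nonempty by blast
  then show ?thesis using that eq by blast
qed

lemma raised_shape_commute:
  assumes "Suc l < length lam" "Suc m < length lam" "Suc l < m \<or> Suc m < l"
  shows "raised_shape l c (raised_shape m d lam) = raised_shape m d (raised_shape l c lam)"
  using assms by (intro nth_equalityI) (auto simp: nth_raised_shape)

text \<open>
  Apply the two commuting operators to $u$ in either order. One of them turns $u$ into a
  multiple of the sum of all tabloids, and the other multiplies this sum by a binomial
  coefficient.
\<close>

lemma distant_rows_proportional:
  fixes u :: "nat set list \<Rightarrow> 'k::field"
  assumes l: "Suc l < length lam" "c \<le> lam ! Suc l" and m: "Suc m < length lam" "d \<le> lam ! Suc m"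
    and far: "Suc l < m \<or> Suc m < l"
    and a: "\<And>V. V \<in> tabloids (raised_shape l c lam) \<Longrightarrow> raise l c u V = a"
    and b: "\<And>V. V \<in> tabloids (raised_shape m d lam) \<Longrightarrow> raise m d u V = b"
  shows "of_nat ((lam ! l + c) choose c) * b = of_nat ((lam ! m + d) choose d) * a"
proof -
  let ?mu = "raised_shape l c (raised_shape m d lam)"
  have sw: "?mu = raised_shape m d (raised_shape l c lam)" using l(1) m(1) far by (rule raised_shape_commute)
  obtain V where V: "V \<in> tabloids ?mu" using tabloids_nonempty by blast
  then have len: "length V = length lam" by (auto simp: tabloids_iff set_partition_def)
  have "raise l c (raise m d u) V = of_nat ((raised_shape m d lam ! l + c) choose c) * b"
    by (rule raise_constant[OF _ _ V b]) (use l m far in \<open>auto simp: nth_raised_shape\<close>)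
  moreover have "raise m d (raise l c u) V = of_nat ((raised_shape l c lam ! m + d) choose d) * a"
    by (rule raise_constant[OF _ _ V[unfolded sw] a]) (use l m far in \<open>auto simp: nth_raised_shape\<close>)
  moreover have "raise l c (raise m d u) V = raise m d (raise l c u) V"
    using l m far len by (intro raise_commute) auto
  moreover have "raised_shape m d lam ! l = lam ! l" "raised_shape l c lam ! m = lam ! m"
    using l m far by (auto simp: nth_raised_shape)
  ultimately show ?thesis by simp
qed

text \<open>
  Write $A_{l,e}$ for the constant value of the raised $u$ and $B_{l,e}$ for that of the raised
  sum of all tabloids, a binomial coefficient. If $A = \alpha B$ for all $l$ and $e$, then $u$
  minus $\alpha$ times the sum of all tabloids is killed by all raising operators. By the
  proportionality for distant rows, row $i$, where $B_{i,c} \neq 0$, determines $A$ on all rows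
  other than $i - 1$, $i$ and $i + 1$, with the factor $A_{i,c} / B_{i,c}$; row $j$ does the
  same away from $j - 1$, $j$ and $j + 1$. As $j > i + 2$, the two exceptional ranges are
  disjoint, and the two factors agree because $i$ and $j$ are themselves distant.
\<close>

lemma highest_weight_modulo_tabloid_sum:
  fixes u :: "nat set list \<Rightarrow> 'k::field"
  assumes u: "u \<in> perm_module lam"
    and hw: "\<And>g. g permutes {1..sum_list lam} \<Longrightarrow> highest_weight lam (perm_act g u - u)"
    and ij: "i + 2 < j" "Suc j < length lam"
    and c: "0 < c" "c \<le> lam ! Suc i" "of_nat ((lam ! i + c) choose c) \<noteq> (0 :: 'k)"
    and d: "0 < d" "d \<le> lam ! Suc j" "of_nat ((lam ! j + d) choose d) \<noteq> (0 :: 'k)"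
  obtains \<alpha> where "highest_weight lam (u - scale \<alpha> (tabloid_sum lam))"
proof -
  define B where "B l e = (of_nat ((lam ! l + e) choose e) :: 'k)" for l e
  define A where "A l e = (SOME a. \<forall>V \<in> tabloids (raised_shape l e lam). raise l e u V = a)" for l e
  have A: "raise l e u V = A l e"
    if le: "Suc l < length lam" "0 < e" "e \<le> lam ! Suc l" and V: "V \<in> tabloids (raised_shape l e lam)" for l e V
  proof -
    have "\<exists>a. \<forall>V \<in> tabloids (raised_shape l e lam). raise l e u V = a"
      using raise_constant_on_tabloids[OF hw le] by metis
    from someI_ex[OF this] show ?thesis using V unfolding A_def by blast
  qed
  have far: "B l e * A m f = B m f * A l e"
    if "Suc l < length lam" "0 < e" "e \<le> lam ! Suc l" "Suc m < length lam" "0 < f" "f \<le> lam ! Suc m"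
      "Suc l < m \<or> Suc m < l" for l e m f
    unfolding B_def
    by (rule distant_rows_proportional[OF that(1,3,4,6,7)]) (use A that in blast)+
  have i: "Suc i < length lam" using ij by simp
  have Bi: "B i c \<noteq> 0" and Bj: "B j d \<noteq> 0" using c(3) d(3) by (simp_all add: B_def)
  define \<alpha> where "\<alpha> = A i c / B i c"
  have "B i c * A j d = B j d * A i c"
    by (rule far) (use ij c d in auto)
  then have \<alpha>j: "\<alpha> = A j d / B j d" using Bi Bj by (simp add: \<alpha>_def field_simps)
  have A_eq: "A l e = \<alpha> * B l e" if le: "Suc l < length lam" "0 < e" "e \<le> lam ! Suc l" for l e
  proof (cases "Suc i < l \<or> Suc l < i")
    case True
    then have "B i c * A l e = B l e * A i c" using far[OF i c(1,2) le] by blast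
    then show ?thesis using Bi by (simp add: \<alpha>_def field_simps)
  next
    case False
    then have "Suc l < j" using ij(1) by linarith
    then have "B j d * A l e = B l e * A j d" using far[OF ij(2) d(1,2) le] by blast
    then show ?thesis using Bj by (simp add: \<alpha>j field_simps)
  qed
  have "highest_weight lam (u - scale \<alpha> (tabloid_sum lam))"
  proof (rule highest_weightI)
    show "u - scale \<alpha> (tabloid_sum lam) \<in> perm_module lam"
      using u by (auto simp: perm_module_iff scale_def tabloid_sum_def)
    fix l e V
    assume le: "Suc l < length lam" "0 < e" "e \<le> lam ! Suc l" and V: "V \<in> tabloids (raised_shape l e lam)"
    have "raise l e (tabloid_sum lam) V = B l e * 1"
      unfolding B_def by (rule raise_constant[OF le(1,3) V]) (simp add: tabloid_sum_def)
    then show "raise l e (u - scale \<alpha> (tabloid_sum lam)) V = 0"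
      by (simp add: raise_diff raise_scale A[OF le V] A_eq[OF le])
  qed
  then show ?thesis by (rule that)
qed

theorem corollary18:
  fixes p n i j :: nat and lam :: "nat list"
  assumes "prime p" and "p \<ge> 3" and "CHAR('k::field) = p"
    and "partition_of lam n" and "length lam \<ge> 5"
    and "2 < i + 2" and "i + 2 < j" and "j < length lam"
    and "\<not> James p (part lam i) (part lam (i + 1))"
    and "\<not> James p (part lam j) (part lam (j + 1))"
  shows "trivial_group
    (cohomology 1 (sym_group n) (specht lam :: (nat set list \<Rightarrow> 'k) set) perm_act)"
proof -
  note lam = \<open>partition_of lam n\<close>
  have n: "n = sum_list lam" and pos: "\<And>r. r < length lam \<Longrightarrow> 0 < lam ! r"
    using lam by (auto simp: partition_of_def)
  have zero_iff: "of_nat x = (0 :: 'k) \<longleftrightarrow> p dvd x" for x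
    using assms(3) of_nat_eq_0_iff_char_dvd[where 'a = 'k] by simp
  have two: "(2 :: 'k) \<noteq> 0"
    using zero_iff[of 2] \<open>p \<ge> 3\<close> by (auto dest: dvd_imp_le)
  have binom: "\<exists>d. 0 < d \<and> d \<le> lam ! Suc r \<and> of_nat ((lam ! r + d) choose d) \<noteq> (0 :: 'k)"
    if "Suc r < length lam" "\<not> James p (lam ! r) (lam ! Suc r)" for r
    using not_James_binomial[OF \<open>prime p\<close> pos[OF that(1)] that(2)] unfolding zero_iff by metis
  \<comment> \<open>Parts are counted from 1 in the statement and rows from 0 in the lemmas.\<close>
  have i: "Suc (i - 1) = i" and j: "Suc (j - 1) = j" using assms by auto
  obtain c where c: "0 < c" "c \<le> lam ! Suc (i - 1)" "of_nat ((lam ! (i - 1) + c) choose c) \<noteq> (0 :: 'k)"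
    using binom[of "i - 1"] assms by (auto simp: part_def i)
  obtain d where d: "0 < d" "d \<le> lam ! Suc (j - 1)" "of_nat ((lam ! (j - 1) + d) choose d) \<noteq> (0 :: 'k)"
    using binom[of "j - 1"] assms by (auto simp: part_def j)
  show ?thesis
    unfolding n cohomology_1_specht_trivial_iff sym_group_carrier
  proof (intro ballI impI)
    fix f :: "(nat \<Rightarrow> nat) \<Rightarrow> nat set list \<Rightarrow> 'k"
    assume f: "f \<in> carrier (sym_group (sum_list lam)) \<rightarrow> specht lam"
      and cocycle: "\<forall>g\<in>carrier (sym_group (sum_list lam)). \<forall>h\<in>carrier (sym_group (sum_list lam)).
        f (g \<circ> h) = f g + perm_act g (f h)"
    have fS: "f g \<in> specht lam" if "g permutes {1..sum_list lam}" for g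
      using f that by (auto simp: sym_group_carrier)
    have fP: "f g \<in> perm_module lam" if "g permutes {1..sum_list lam}" for g
      using fS[OF that] specht_subset_perm_module by blast
    have f_comp: "f (g \<circ> h) = f g + perm_act g (f h)"
      if "g permutes {1..sum_list lam}" "h permutes {1..sum_list lam}" for g h
      using cocycle that by (simp only: sym_group_carrier mem_Collect_eq)
    obtain u where u: "u \<in> perm_module lam"
      and fu: "\<And>g. g permutes {1..sum_list lam} \<Longrightarrow> f g = perm_act g u - u"
      using perm_module_cocycle_is_coboundary[OF two f_comp fP] by blast
    have hw: "highest_weight lam (perm_act g u - u)" if "g permutes {1..sum_list lam}" for g
      using specht_highest_weight[OF lam fS[OF that]] fu[OF that] by simp
    have ij: "i - 1 + 2 < j - 1" "Suc (j - 1) < length lam" using assms by auto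
    obtain \<alpha> where \<alpha>: "highest_weight lam (u - scale \<alpha> (tabloid_sum lam))"
      using highest_weight_modulo_tabloid_sum[OF u hw ij c d] by blast
    let ?m = "u - scale \<alpha> (tabloid_sum lam)"
    have "?m \<in> perm_module lam"
      using u by (auto simp: perm_module_iff scale_def tabloid_sum_def)
    then have m: "?m \<in> specht lam" by (rule highest_weight_in_specht[OF lam \<alpha>])
    have "f g = perm_act g ?m - ?m" if g: "g permutes {1..sum_list lam}" for g
    proof -
      have "perm_act g ?m = perm_act g u - scale \<alpha> (perm_act g (tabloid_sum lam))"
        by (simp add: perm_act_def scale_def fun_eq_iff)
      then show ?thesis using fu[OF g] by (simp add: perm_act_tabloid_sum[OF g])
    qed
    then show "\<exists>m\<in>specht lam. \<forall>g\<in>carrier (sym_group (sum_list lam)). f g = perm_act g m - m"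
      using m by (auto simp: sym_group_carrier)
  qed
qed

end
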